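(* Let $f(N,d)$ denote the maximum sign rank of an $N\times N$ sign matrix with VC dimension $d$. Then, as $N\to\infty$: 1. $f(N,2) \geq \Omega(N^{1/2}/ \log N)$; 2. $f(N,3) \geq \Omega(N^{8/15}/\log N)$; 3. $f(N,4) \geq \Omega(N^{2/3}/\log N)$; 4. for every fixed $d>4$, $f(N,d) \geq \Omega\!\left(N^{1-(d^2+5d+2)/(d^3+2d^2+3d)}/ \log N\right)$.
   Context: A sign matrix has entries in $\{\pm1\}$. Its sign rank is $\min\{\text{rank}(M): \text{sign}(M)=S\}$ over real matrices $M$ with no zero entries, where $\text{sign}$ is applied entrywise and rank is over $\mathbb R$. A set $C$ of columns is shattered if every pattern in $\{\pm1\}^C$ appears as a row of the restriction of $S$ to $C$; the VC dimension is the maximum size of a shattered set of columns. *)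

theory Defs
  imports
    "Jordan_Normal_Form.DL_Rank"
    "HOL-Library.Landau_Symbols"
    "HOL-Library.FuncSet"
begin

definition sign_matrix :: "real mat \<Rightarrow> bool" where
  "sign_matrix S \<longleftrightarrow> elements_mat S \<subseteq> {-1, 1}"

definition sign_rank :: "real mat \<Rightarrow> nat" where
  "sign_rank S = (LEAST r. \<exists>M \<in> carrier_mat (dim_row S) (dim_col S).
     0 \<notin> elements_mat M \<and> map_mat sgn M = S \<and> vec_space.rank (dim_row S) M = r)"

definition shattered :: "real mat \<Rightarrow> nat set \<Rightarrow> bool" where
  "shattered S C \<longleftrightarrow> C \<subseteq> {..<dim_col S} \<and>
     (\<forall>p \<in> C \<rightarrow> {-1, 1}. \<exists>i < dim_row S. \<forall>j \<in> C. S $$ (i, j) = p j)"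

definition VC_dim :: "real mat \<Rightarrow> nat" where
  "VC_dim S = Max {card C |C. shattered S C}"

text \<open>The set below is finite, and it is nonempty for \<open>N \<ge> 2 ^ d\<close>. For smaller \<open>N\<close> there may be
  no matrix of VC dimension \<open>d\<close>, and the value of \<^const>\<open>Max\<close> on the empty set is unspecified;
  this does not affect the behaviour as \<open>N\<close> tends to infinity for fixed \<open>d\<close>.\<close>

definition max_sign_rank :: "nat \<Rightarrow> nat \<Rightarrow> nat" where
  "max_sign_rank N d =
     Max {sign_rank S |S. S \<in> carrier_mat N N \<and> sign_matrix S \<and> VC_dim S = d}"

end

theory Submission
  imports
    Defs
    "HOL-Analysis.Function_Topology"
    "HOL-Algebra.Algebraic_Closure_Type"
begin

text \<open>
  The argument compares two counts. A matrix of sign rank at most \<open>r\<close> is the sign pattern of \<open>N\<^sup>2\<close>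
  quadratic polynomials in \<open>2 r N\<close> variables, so there are at most \<open>N ^ O(r N)\<close> of them. On the other hand,
  if a bipartite graph on \<open>n + n\<close> vertices avoids a suitable part of the incidence structure of a shattered
  set of \<open>d + 1\<close> columns, then so do all of its \<open>2 ^ m\<close> subgraphs (\<open>m\<close> the number of edges), and each of
  them yields a matrix of VC dimension \<open>d\<close>. Hence the maximal sign rank is at least of order
  \<open>m / (N ln N)\<close>. For \<open>d = 2\<close> the point-line incidences of an affine plane avoid \<open>K\<^sub>2\<^sub>,\<^sub>2\<close>; for
  \<open>d = 4\<close> a variant of Brown's graph, \<open>Q (x - a) = g\<close> with \<open>Q = x\<^sub>1\<^sup>2 - x\<^sub>2 x\<^sub>3\<close> and \<open>g\<close> a nonsquare, avoids
  \<open>K\<^sub>3\<^sub>,\<^sub>3\<close>; in the other cases the deletion method is applied to the rows with at least \<open>3\<close>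
  (for \<open>d = 3\<close>) or \<open>d - 1\<close> (for \<open>d > 4\<close>) positive entries.
\<close>

section \<open>A weak form of Warren's theorem\<close>

text \<open>A pattern-free graph with about n^(2 - a) edges forces sign rank of order N^(1 - a) / ln
  N, since 2^m <= (4 N^2 + 1)^(2 N r). Every family \<open>T\<close> of nonempty subsets of
  \<open>{..d}\<close> occurs among the rows of a shattered set, so \<open>T\<close> may be chosen
  freely to make the avoiding graph dense. A triple has two subsets containing a given pair, and a
  set of five has four subsets containing a given triple; this is where K_{2,2} at d = 2 and K_{3,3}
  at d = 4 come from, with a = 1/2 and a = 1/3. Deletion gives a = (v - 2) / (e - 1) for v vertices
  and e edges in the configuration. A row with k positive entries adds one vertex and k edges, so
  sparse rows raise this ratio and are left out. The upper count has to bound the solutions of a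
  polynomial system without Bezout. The perturbation by pure powers brings the critical equations
  into the form x_i^(2 m + 1) = (degree at most 2 m), and such systems yield to linear
  algebra.\<close>

inductive_set polyfun :: "nat \<Rightarrow> nat \<Rightarrow> ((nat \<Rightarrow> real) \<Rightarrow> real) set" for n t where
  monom: "(\<Sum>i<n. \<alpha> i) \<le> t \<Longrightarrow> (\<lambda>x. c * (\<Prod>i<n. x i ^ \<alpha> i)) \<in> polyfun n t"
| add: "f \<in> polyfun n t \<Longrightarrow> g \<in> polyfun n t \<Longrightarrow> (\<lambda>x. f x + g x) \<in> polyfun n t"

lemma polyfun_const: "(\<lambda>x. c) \<in> polyfun n t"
  using polyfun.monom[of "\<lambda>_. 0" n t c] by simp

lemma polyfun_mono: "f \<in> polyfun n s \<Longrightarrow> s \<le> t \<Longrightarrow> f \<in> polyfun n t"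
  by (induction rule: polyfun.induct) (auto intro: polyfun.intros)

lemma polyfun_var: 
  assumes "i < n" shows "(\<lambda>x. x i) \<in> polyfun n 1"
proof -
  have "(\<Prod>j<n. x j ^ (if j = i then 1 else 0)) = x i" for x :: "nat \<Rightarrow> real"
    using assms by (simp add: prod.remove[of "{..<n}" i])
  moreover have "(\<Sum>j<n. (if j = i then 1 else 0 :: nat)) \<le> 1" by simp
  ultimately show ?thesis
    using polyfun.monom[of "\<lambda>j. if j = i then 1 else 0" n 1 1] by simp
qed

lemma polyfun_mult:
  assumes "f \<in> polyfun n s" "g \<in> polyfun n t"
  shows "(\<lambda>x. f x * g x) \<in> polyfun n (s + t)"
  using assms(1)
proof (induction rule: polyfun.induct)
  case (monom \<alpha> c)
  show ?case using assms(2)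
  proof (induction rule: polyfun.induct)
    case (monom \<beta> d)
    have "(\<lambda>x. c * (\<Prod>i<n. x i ^ \<alpha> i) * (d * (\<Prod>i<n. x i ^ \<beta> i)))
        = (\<lambda>x. (c * d) * (\<Prod>i<n. x i ^ (\<alpha> i + \<beta> i)))"
      by (simp add: power_add prod.distrib mult_ac)
    moreover have "(\<Sum>i<n. \<alpha> i + \<beta> i) \<le> s + t"
      using monom \<open>(\<Sum>i<n. \<alpha> i) \<le> s\<close> by (simp add: sum.distrib)
    ultimately show ?case by (auto intro: polyfun.monom)
  next
    case (add f g)
    then show ?case by (simp only: distrib_left) (rule polyfun.add)
  qed
next
  case (add f g)
  then show ?case by (simp only: distrib_right) (rule polyfun.add)
qed

lemma polyfun_cmult: "f \<in> polyfun n t \<Longrightarrow> (\<lambda>x. c * f x) \<in> polyfun n t"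
  using polyfun_mult[OF polyfun_const[of c n 0], of f t] by simp

lemma polyfun_diff: "f \<in> polyfun n t \<Longrightarrow> g \<in> polyfun n t \<Longrightarrow> (\<lambda>x. f x - g x) \<in> polyfun n t"
  using polyfun.add[of f n t "\<lambda>x. (-1) * g x"] polyfun_cmult[of g n t "-1"] by simp

lemma polyfun_sum:
  "(\<And>a. a \<in> A \<Longrightarrow> f a \<in> polyfun n t) \<Longrightarrow> (\<lambda>x. \<Sum>a\<in>A. f a x) \<in> polyfun n t"
  by (induction A rule: infinite_finite_induct) (auto intro: polyfun_const polyfun.add)

lemma polyfun_prod:
  "finite A \<Longrightarrow> (\<And>a. a \<in> A \<Longrightarrow> f a \<in> polyfun n t) \<Longrightarrow> (\<lambda>x. \<Prod>a\<in>A. f a x) \<in> polyfun n (card A * t)"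
  by (induction A rule: finite_induct) (auto intro: polyfun_const polyfun_mult)

lemma polyfun_cong: "f \<in> polyfun n t \<Longrightarrow> (\<And>i. i < n \<Longrightarrow> x i = y i) \<Longrightarrow> f x = f y"
  by (induction rule: polyfun.induct) auto

lemma polyfun_continuous: "f \<in> polyfun n t \<Longrightarrow> continuous_on S f"
  by (induction rule: polyfun.induct) 
     (auto intro!: continuous_intros continuous_on_product_coordinates intro: continuous_on_subset)

lemma polyfun_deriv:
  assumes "f \<in> polyfun n (Suc t)" "i < n"
  shows "\<exists>g \<in> polyfun n t. \<forall>x. ((\<lambda>s. f (x(i := s))) has_real_derivative g x) (at (x i))"
  using assms(1)
proof (induction rule: polyfun.induct)
  case (monom \<alpha> c)
  \<comment> \<open>Truncated subtraction is harmless: for \<open>\<alpha> i = 0\<close> the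
    coefficient \<open>c * \<alpha> i\<close> of \<open>g\<close> vanishes.\<close>
  define \<beta> where "\<beta> = \<alpha>(i := \<alpha> i - 1)"
  define g where "g = (\<lambda>x::nat \<Rightarrow> real. (c * \<alpha> i) * (\<Prod>j<n. x j ^ \<beta> j))"
  have split: "(\<Prod>j<n. x j ^ \<gamma> j) = x i ^ \<gamma> i * (\<Prod>j\<in>{..<n}-{i}. x j ^ \<gamma> j)" for x :: "nat \<Rightarrow> real" and \<gamma>
    using assms(2) by (simp add: prod.remove[of "{..<n}" i])
  have "g \<in> polyfun n t"
  proof (cases "\<alpha> i = 0")
    case True
    then show ?thesis by (simp add: g_def polyfun_const)
  next
    case False
    have "(\<Sum>j<n. \<alpha> j) = Suc (\<Sum>j<n. \<beta> j)"
      using assms(2) False by (simp add: sum.remove[of "{..<n}" i] \<beta>_def)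
    then show ?thesis using monom unfolding g_def by (intro polyfun.monom) auto
  qed
  moreover have "((\<lambda>s. c * (\<Prod>j<n. (x(i := s)) j ^ \<alpha> j)) has_real_derivative g x) (at (x i))" for x
    unfolding split g_def by (auto intro!: derivative_eq_intros simp: \<beta>_def)
  ultimately show ?case by blast
next
  case (add f g)
  then obtain f' g' where "f' \<in> polyfun n t" "g' \<in> polyfun n t"
    "\<forall>x. ((\<lambda>s. f (x(i := s))) has_real_derivative f' x) (at (x i))"
    "\<forall>x. ((\<lambda>s. g (x(i := s))) has_real_derivative g' x) (at (x i))" by blast
  then show ?case by (intro bexI[of _ "\<lambda>x. f' x + g' x"]) (auto intro: polyfun.add simp del: fun_upd_apply intro!: DERIV_add)
qed

lemma polyfun_bound:
  assumes "f \<in> polyfun n t"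
  shows "\<exists>C\<ge>0. \<forall>R\<ge>1. \<forall>x. (\<forall>i<n. \<bar>x i\<bar> \<le> R) \<longrightarrow> \<bar>f x\<bar> \<le> C * R ^ t"
  using assms
proof (induction rule: polyfun.induct)
  case (monom \<alpha> c)
  have "\<bar>c * (\<Prod>i<n. x i ^ \<alpha> i)\<bar> \<le> \<bar>c\<bar> * R ^ t" if "R \<ge> 1" "\<forall>i<n. \<bar>x i\<bar> \<le> R" for R x
  proof -
    have "\<bar>\<Prod>i<n. x i ^ \<alpha> i\<bar> = (\<Prod>i<n. \<bar>x i\<bar> ^ \<alpha> i)" by (simp add: abs_prod power_abs)
    also have "\<dots> \<le> (\<Prod>i<n. R ^ \<alpha> i)" using that by (intro prod_mono) (auto intro: power_mono)
    also have "\<dots> = R ^ (\<Sum>i<n. \<alpha> i)" by (simp add: power_sum)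
    also have "\<dots> \<le> R ^ t" using that monom by (intro power_increasing) auto
    finally show ?thesis by (simp add: abs_mult mult_left_mono)
  qed
  then show ?case by (intro exI[of _ "\<bar>c\<bar>"]) auto
next
  case (add f g)
  then obtain C D where "C \<ge> 0" "D \<ge> 0"
    and C: "\<And>R x. R \<ge> 1 \<Longrightarrow> (\<forall>i<n. \<bar>x i\<bar> \<le> R) \<Longrightarrow> \<bar>f x\<bar> \<le> C * R ^ t"
    and D: "\<And>R x. R \<ge> 1 \<Longrightarrow> (\<forall>i<n. \<bar>x i\<bar> \<le> R) \<Longrightarrow> \<bar>g x\<bar> \<le> D * R ^ t" by blast
  have "\<bar>f x + g x\<bar> \<le> (C + D) * R ^ t" if "R \<ge> 1" "\<forall>i<n. \<bar>x i\<bar> \<le> R" for R x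
    using C[OF that] D[OF that] by (auto simp: distrib_right)
  with \<open>C \<ge> 0\<close> \<open>D \<ge> 0\<close> show ?case by (intro exI[of _ "C + D"]) auto
qed

section \<open>Counting common zeros by linear algebra\<close>

lemma underdetermined_system_nontrivial_solution:
  fixes \<phi> :: "'b \<Rightarrow> 'a \<Rightarrow> real"
  assumes "finite B" "finite Z" "card B < card Z"
  shows "\<exists>c. (\<exists>z\<in>Z. c z \<noteq> 0) \<and> (\<forall>b\<in>B. (\<Sum>z\<in>Z. c z * \<phi> b z) = 0)"
  using assms
proof (induction B arbitrary: Z \<phi> rule: finite_induct)
  case empty
  then obtain z where "z \<in> Z" by (auto simp: card_gt_0_iff)
  then show ?case by (intro exI[of _ "\<lambda>_. 1"]) auto
next
  case (insert b B)
  show ?case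
  proof (cases "\<forall>z\<in>Z. \<phi> b z = 0")
    case True
    obtain c where "(\<exists>z\<in>Z. c z \<noteq> 0)" "(\<forall>b\<in>B. (\<Sum>z\<in>Z. c z * \<phi> b z) = 0)"
      using insert.IH[of Z \<phi>] insert by fastforce
    with True show ?thesis by (intro exI[of _ c]) auto
  next
    case False
    then obtain w where w: "w \<in> Z" "\<phi> b w \<noteq> 0" by blast
    have "card B < card (Z - {w})" using insert w by auto
    \<comment> \<open>Gaussian elimination: equation \<open>b\<close> is solved for the unknown at
      \<open>w\<close> and substituted into the remaining equations.\<close>
    from insert.IH[OF finite_Diff[OF insert.prems(1)] this,
        of "\<lambda>b' z. \<phi> b' z - \<phi> b' w / \<phi> b w * \<phi> b z"]
    obtain c where c: "\<exists>z\<in>Z - {w}. c z \<noteq> 0"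
      "\<forall>b'\<in>B. (\<Sum>z\<in>Z - {w}. c z * (\<phi> b' z - \<phi> b' w / \<phi> b w * \<phi> b z)) = 0"
      by (elim exE conjE)
    define c' where "c' = c(w := - (\<Sum>z\<in>Z - {w}. c z * \<phi> b z) / \<phi> b w)"
    have split: "(\<Sum>z\<in>Z. c' z * f z)
        = - (\<Sum>z\<in>Z - {w}. c z * \<phi> b z) / \<phi> b w * f w + (\<Sum>z\<in>Z - {w}. c z * f z)" for f
    proof -
      have "(\<Sum>z\<in>Z - {w}. c' z * f z) = (\<Sum>z\<in>Z - {w}. c z * f z)"
        by (intro sum.cong) (auto simp: c'_def)
      then show ?thesis using insert.prems w by (simp add: sum.remove[of Z w] c'_def)
    qed
    have "(\<Sum>z\<in>Z. c' z * \<phi> b z) = 0" unfolding split using w by simp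
    moreover have "(\<Sum>z\<in>Z. c' z * \<phi> b' z) = 0" if "b' \<in> B" for b'
    proof -
      have "(\<Sum>z\<in>Z - {w}. c z * (\<phi> b' z - \<phi> b' w / \<phi> b w * \<phi> b z))
          = (\<Sum>z\<in>Z - {w}. c z * \<phi> b' z) - \<phi> b' w / \<phi> b w * (\<Sum>z\<in>Z - {w}. c z * \<phi> b z)"
        by (simp add: right_diff_distrib sum_subtractf sum_distrib_left mult_ac)
      with c(2)[rule_format, OF that] show ?thesis unfolding split by (simp add: mult_ac)
    qed
    moreover have "\<exists>z\<in>Z. c' z \<noteq> 0" using c(1) by (auto simp: c'_def)
    ultimately show ?thesis by blast
  qed
qed

text \<open>On \<open>Z\<close> the equations rewrite every monomial into the
  \<open>Suc k ^ n\<close> monomials with all exponents at most \<open>k\<close>. If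
  \<open>Z\<close> had more points, some nonzero weights \<open>c\<close> would annihilate these
  monomials, hence all polynomials; but the product \<open>L\<close> of linear factors vanishes on
  \<open>Z\<close> except at a point \<open>w\<close> with \<open>c w \<noteq> 0\<close>.\<close>

lemma card_common_zeros_le:
  assumes "finite Z"
    and q: "\<And>i. i < n \<Longrightarrow> q i \<in> polyfun n k"
    and zero: "\<And>z i. z \<in> Z \<Longrightarrow> i < n \<Longrightarrow> z i ^ Suc k = q i z"
    and sep: "\<And>z w. z \<in> Z \<Longrightarrow> w \<in> Z \<Longrightarrow> z \<noteq> w \<Longrightarrow> \<exists>i<n. z i \<noteq> w i"
  shows "card Z \<le> Suc k ^ n"
proof (rule ccontr)
  define B where "B = PiE {..<n} (\<lambda>_. {..k})"
  have "finite B" "card B = Suc k ^ n" by (auto simp: B_def finite_PiE card_PiE)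
  moreover assume "\<not> card Z \<le> Suc k ^ n"
  ultimately obtain c w where w: "w \<in> Z" "c w \<noteq> 0" 
    and c: "\<And>\<beta>. \<beta> \<in> B \<Longrightarrow> (\<Sum>z\<in>Z. c z * (\<Prod>i<n. z i ^ \<beta> i)) = 0"
    using underdetermined_system_nontrivial_solution[of B Z "\<lambda>\<beta> z. (\<Prod>i<n. z i ^ \<beta> i)"] assms(1)
    by auto
  have vanish: "(\<Sum>z\<in>Z. c z * f z) = 0" if "f \<in> polyfun n t" for t f
    using that
  proof (induction t arbitrary: f rule: less_induct)
    case (less t)
    from less.prems show ?case
    proof (induction rule: polyfun.induct)
      case (monom \<alpha> a)
      show ?case
      proof (cases "\<forall>i<n. \<alpha> i \<le> k")
        case True
        then have "restrict \<alpha> {..<n} \<in> B" by (auto simp: B_def)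
        from c[OF this] have "(\<Sum>z\<in>Z. c z * (\<Prod>i<n. z i ^ \<alpha> i)) = 0" by simp
        moreover have "(\<Sum>z\<in>Z. c z * (a * (\<Prod>i<n. z i ^ \<alpha> i)))
          = a * (\<Sum>z\<in>Z. c z * (\<Prod>i<n. z i ^ \<alpha> i))"
          by (simp add: sum_distrib_left mult_ac)
        ultimately show ?thesis by simp
      next
        case False
        then obtain i where i: "i < n" "\<alpha> i \<ge> Suc k" by (auto simp: not_le Suc_le_eq)
        \<comment> \<open>Trading \<open>Suc k\<close> factors \<open>x i\<close> for
          \<open>q i\<close>, of degree at most \<open>k\<close>, lowers the total degree, so the
          induction on \<open>t\<close> applies.\<close>
        define \<beta> where "\<beta> = \<alpha>(i := \<alpha> i - Suc k)"
        have sum: "(\<Sum>j<n. \<alpha> j) = Suc k + (\<Sum>j<n. \<beta> j)"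
          using i by (simp add: sum.remove[of "{..<n}" i] \<beta>_def)
        have "(\<Prod>j<n. x j ^ \<alpha> j) = x i ^ Suc k * (\<Prod>j<n. x j ^ \<beta> j)" for x :: "nat \<Rightarrow> real"
        proof -
          have "x i ^ \<alpha> i = x i ^ Suc k * x i ^ (\<alpha> i - Suc k)" 
            using i(2) by (metis le_add_diff_inverse power_add)
          then show ?thesis using i by (simp add: prod.remove[of "{..<n}" i] \<beta>_def)
        qed
        then have "(\<Sum>z\<in>Z. c z * (a * (\<Prod>i<n. z i ^ \<alpha> i)))
            = (\<Sum>z\<in>Z. c z * (q i z * (a * (\<Prod>j<n. z j ^ \<beta> j))))"
          using zero i(1) by (intro sum.cong) (auto simp: mult_ac)
        also have "\<dots> = 0"
          by (rule less.IH[of "k + (\<Sum>j<n. \<beta> j)"])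
             (use sum monom in \<open>auto intro!: polyfun_mult q i polyfun.monom\<close>)
        finally show ?thesis .
      qed
    next
      case (add f g)
      then show ?case by (simp add: distrib_left sum.distrib)
    qed
  qed
  obtain \<iota> where \<iota>: "\<And>z. z \<in> Z \<Longrightarrow> z \<noteq> w \<Longrightarrow> \<iota> z < n \<and> z (\<iota> z) \<noteq> w (\<iota> z)"
    using sep w(1) by metis
  define L where "L = (\<lambda>x::nat \<Rightarrow> real. \<Prod>z\<in>Z - {w}. x (\<iota> z) - z (\<iota> z))"
  have "L \<in> polyfun n (card (Z - {w}) * 1)"
    unfolding L_def by (rule polyfun_prod)
      (use \<iota> \<open>finite Z\<close> in \<open>auto intro!: polyfun_diff polyfun_const polyfun_var[simplified]\<close>)
  then have "(\<Sum>z\<in>Z. c z * L z) = 0" by (rule vanish)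
  moreover have "(\<Sum>z\<in>Z. c z * L z) = c w * L w"
  proof -
    have "L z = 0" if "z \<in> Z - {w}" for z
      using that \<open>finite Z\<close> by (auto simp: L_def prod_zero_iff)
    then show ?thesis using \<open>finite Z\<close> w by (simp add: sum.remove[of Z w])
  qed
  moreover have "L w \<noteq> 0" using \<iota> \<open>finite Z\<close> by (auto simp: L_def prod_zero_iff) metis
  ultimately show False using w by simp
qed


section \<open>Critical points in sign cells\<close>

lemma ex_pos_mult_less:
  fixes u v :: "'a \<Rightarrow> real"
  assumes "finite A" "\<And>a. a \<in> A \<Longrightarrow> u a > 0" "\<And>a. a \<in> A \<Longrightarrow> v a \<ge> 0"
  shows "\<exists>\<delta>>0. \<forall>a\<in>A. \<delta> * v a < u a"
  using assms
proof (induction A rule: finite_induct)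
  case empty
  show ?case by (intro exI[of _ 1]) auto
next
  case (insert a A)
  then obtain \<delta> where \<delta>: "\<delta> > 0" "\<forall>a\<in>A. \<delta> * v a < u a" by auto
  define \<epsilon> where "\<epsilon> = u a / (1 + v a)"
  have "u a > 0" "v a \<ge> 0" using insert by auto
  then have "\<epsilon> > 0" "\<epsilon> * v a < u a" by (auto simp: \<epsilon>_def field_simps)
  moreover have "min \<delta> \<epsilon> * v b \<le> \<delta> * v b" "min \<delta> \<epsilon> * v b \<le> \<epsilon> * v b" if "b \<in> insert a A" for b
    using insert.prems(2)[OF that] by (auto intro!: mult_right_mono)
  ultimately show ?case using \<delta>
    by (intro exI[of _ "min \<delta> \<epsilon>"]) (fastforce intro: le_less_trans)
qed

text \<open>Points are functions on all of \<open>nat\<close>, so bounding the first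
  \<open>n\<close> coordinates is not enough for compactness in the product topology; the others are
  pinned to 0.\<close>

lemma compact_box:
  "compact {x :: nat \<Rightarrow> real. (\<forall>i<n. \<bar>x i\<bar> \<le> R) \<and> (\<forall>i\<ge>n. x i = 0)}"
proof -
  have "{x :: nat \<Rightarrow> real. (\<forall>i<n. \<bar>x i\<bar> \<le> R) \<and> (\<forall>i\<ge>n. x i = 0)}
      = PiE UNIV (\<lambda>i. if i < n then {-R..R} else {0})"
    by (auto simp: PiE_iff abs_le_iff split: if_splits) (metis minus_le_iff not_le)+
  moreover have "compactin (product_topology (\<lambda>i::nat. euclidean::real topology) UNIV)
      (PiE UNIV (\<lambda>i. if i < n then {-R..R} else {0}))"
    unfolding compactin_PiE by auto
  ultimately show ?thesis by (simp add: euclidean_product_topology)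
qed

text \<open>A weak form of Warren's theorem. With \<open>P\<close> the product of the polynomials, the function
  \<open>P\<^sup>2 - \<delta> \<Sum> x\<^sub>i ^ (2 m + 2)\<close> is nonpositive on the boundary of every sign cell and far away, but positive
  at the given points, so it has a critical point in each cell; its critical points are bounded by
  \<open>card_common_zeros_le\<close>.\<close>

lemma card_sign_patterns_le:
  assumes "finite J" and p: "\<And>j. j \<in> J \<Longrightarrow> p j \<in> polyfun n k"
    and "finite A" and nz: "\<And>a j. a \<in> A \<Longrightarrow> j \<in> J \<Longrightarrow> p j a \<noteq> 0"
    and dist: "\<And>a b. a \<in> A \<Longrightarrow> b \<in> A \<Longrightarrow> (\<And>j. j \<in> J \<Longrightarrow> sgn (p j a) = sgn (p j b)) \<Longrightarrow> a = b"
  shows "card A \<le> Suc (2 * (card J * k)) ^ n"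
proof -
  define m where "m = card J * k"
  define P where "P = (\<lambda>x. \<Prod>j\<in>J. p j x)"
  define V where "V = (\<lambda>x::nat \<Rightarrow> real. \<Sum>i<n. x i ^ (2 * m + 2))"
  have P: "P \<in> polyfun n m" unfolding P_def m_def using assms by (intro polyfun_prod)
  have PP: "(\<lambda>x. P x * P x) \<in> polyfun n (2 * m)"
    using polyfun_mult[OF P P] by (simp add: mult_2)
  have P0: "P x = 0 \<longleftrightarrow> (\<exists>j\<in>J. p j x = 0)" for x
    using \<open>finite J\<close> by (simp add: P_def)
  have V0: "V x \<ge> 0" for x
    unfolding V_def by (intro sum_nonneg zero_le_even_power) simp
  have "\<exists>\<delta>>0. \<forall>a\<in>A. \<delta> * V a < P a * P a"
  proof (rule ex_pos_mult_less)
    show "0 < P a * P a" if "a \<in> A" for a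
      using nz[OF that] P0[of a] by (metis not_real_square_gt_zero)
  qed (use \<open>finite A\<close> V0 in auto)
  then obtain \<delta> where \<delta>: "\<delta> > 0" "\<And>a. a \<in> A \<Longrightarrow> \<delta> * V a < P a * P a" by blast
  define h where "h = (\<lambda>x. P x * P x - \<delta> * V x)"
  \<comment> \<open>Degree \<open>2 * m\<close> is weakened to \<open>Suc (2 * m)\<close> before
    differentiating, which covers \<open>m = 0\<close>. The bound \<open>2 * m\<close> on the
    derivative is still below the degree \<open>2 * m + 1\<close> of the derivative of the
    perturbation.\<close>
  have "\<forall>i. \<exists>g. i < n \<longrightarrow> g \<in> polyfun n (2 * m) \<and>
      (\<forall>x. ((\<lambda>s. P (x(i := s)) * P (x(i := s))) has_real_derivative g x) (at (x i)))"
    using polyfun_deriv[OF polyfun_mono[OF PP le_SucI[OF order_refl]]] by blast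
  then obtain g where g: "\<And>i. i < n \<Longrightarrow> g i \<in> polyfun n (2 * m)"
    and g': "\<And>i x. i < n \<Longrightarrow> ((\<lambda>s. P (x(i := s)) * P (x(i := s))) has_real_derivative g i x) (at (x i))"
    by metis
  \<comment> \<open>Vanishing of the i-th partial derivative of \<open>h\<close>, solved for the
    pure power \<open>x i ^ (2 * m + 1)\<close>.\<close>
  define q where "q = (\<lambda>i x. 1 / (\<delta> * (2 * m + 2)) * g i x)"
  have h': "((\<lambda>s. h (x(i := s))) has_real_derivative g i x - \<delta> * ((2 * m + 2) * x i ^ (2 * m + 1))) (at (x i))"
    if "i < n" for i and x :: "nat \<Rightarrow> real"
  proof -
    have "V (x(i := s)) = s ^ (2 * m + 2) + (\<Sum>j\<in>{..<n} - {i}. x j ^ (2 * m + 2))" for s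
      unfolding V_def using that by (simp add: sum.remove[of "{..<n}" i])
    then have "((\<lambda>s. V (x(i := s))) has_real_derivative (2 * m + 2) * x i ^ (2 * m + 1)) (at (x i))"
      by (simp only:) (rule derivative_eq_intros refl | simp)+
    then show ?thesis unfolding h_def using g'[OF that]
      by (intro DERIV_diff DERIV_cmult)
  qed
  have contp: "isCont (\<lambda>s. p j (x(i := s))) (x i)" if "j \<in> J" "i < n" for j i x
    using polyfun_deriv[OF polyfun_mono[OF p[OF that(1)] le_SucI[OF order_refl]] that(2)]
    by (blast intro: DERIV_isCont)
  have "\<exists>z. (\<forall>i<n. z i ^ Suc (2 * m) = q i z) \<and> (\<forall>i\<ge>n. z i = 0) \<and> (\<forall>j\<in>J. sgn (p j z) = sgn (p j a))"
    if a: "a \<in> A" for a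
  proof -
    \<comment> \<open>Truncation moves the point into the compact box without changing any
      \<open>p j\<close>.\<close>
    define a' where "a' = (\<lambda>i. if i < n then a i else 0)"
    have pa': "p j a' = p j a" if "j \<in> J" for j
      by (rule polyfun_cong[OF p[OF that]]) (simp add: a'_def)
    have "h a' = h a" by (simp add: h_def P_def V_def a'_def[symmetric] pa') (simp add: a'_def)
    then have ha': "h a' > 0" using \<delta>(2)[OF a] by (simp add: h_def)
    obtain C where C: "C \<ge> 0"
      "\<And>R x. R \<ge> 1 \<Longrightarrow> (\<forall>i<n. \<bar>x i\<bar> \<le> R) \<Longrightarrow> \<bar>P x * P x\<bar> \<le> C * R ^ (2 * m)"
      using polyfun_bound[OF PP] by blast
    \<comment> \<open>The sum puts \<open>a'\<close> into the box; 1 and \<open>C / \<delta>\<close>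
      give \<open>C \<le> \<delta> * R\<^sup>2\<close>, so that \<open>h\<close> is nonpositive at a
      point of the box with a coordinate of modulus \<open>R\<close>.\<close>
    define R where "R = 1 + (\<Sum>i<n. \<bar>a i\<bar>) + C / \<delta>"
    have sum0: "0 \<le> (\<Sum>i<n. \<bar>a i\<bar>)" by (simp add: sum_nonneg)
    have R1: "R \<ge> 1" using C \<delta> sum0 by (simp add: R_def)
    have "\<bar>a i\<bar> \<le> R" if "i < n" for i
      using member_le_sum[of i "{..<n}" "\<lambda>i. \<bar>a i\<bar>"] that C \<delta> by (simp add: R_def add_increasing2)
    then have a'R: "\<forall>i<n. \<bar>a' i\<bar> \<le> R" by (simp add: a'_def)
    have CR: "C \<le> \<delta> * R\<^sup>2"
    proof -
      have "C / \<delta> \<le> R" using sum0 by (simp add: R_def)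
      also have "R \<le> R\<^sup>2" using R1 by (simp add: power2_eq_square)
      finally show ?thesis using \<delta> by (simp add: field_simps)
    qed
    \<comment> \<open>The closed sign cell of \<open>a\<close> cut off by the box. Since
      \<open>h a' > 0\<close>, while \<open>h \<le> 0\<close> wherever some \<open>p j\<close>
      vanishes or a coordinate has modulus \<open>R\<close>, the maximum of \<open>h\<close> on
      \<open>S\<close> lies off its boundary.\<close>
    define S where "S = {x. (\<forall>i<n. \<bar>x i\<bar> \<le> R) \<and> (\<forall>i\<ge>n. x i = 0)} \<inter> (\<Inter>j\<in>J. {x. 0 \<le> sgn (p j a) * p j x})"
    have "compact S" unfolding S_def
      by (intro compact_Int_closed compact_box closed_INT ballI closed_Collect_le)
         (auto intro!: continuous_on_mult_left polyfun_continuous[OF p] continuous_on_const)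
    moreover have "a' \<in> S" using a'R pa' unfolding S_def by (auto simp: sgn_if) (auto simp: a'_def)
    moreover have "continuous_on S h"
      unfolding h_def V_def using polyfun_continuous[OF P]
      by (intro continuous_intros) (auto intro: continuous_on_subset continuous_on_product_coordinates)
    ultimately obtain z where z: "z \<in> S" "\<And>y. y \<in> S \<Longrightarrow> h y \<le> h z"
      using continuous_attains_sup[of S h] by blast
    have hz: "h z > 0" using z(2)[OF \<open>a' \<in> S\<close>] ha' by simp
    then have "P z \<noteq> 0" using mult_nonneg_nonneg[OF less_imp_le[OF \<delta>(1)] V0[of z]] by (auto simp: h_def)
    then have pz: "p j z \<noteq> 0" if "j \<in> J" for j using P0 that by blast
    have sz: "sgn (p j a) * p j z > 0" if "j \<in> J" for j
      using z(1) pz[OF that] nz[OF a that] that by (fastforce simp: S_def sgn_if split: if_splits)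
    have zR: "\<bar>z i\<bar> < R" if "i < n" for i
    proof (rule ccontr)
      assume "\<not> \<bar>z i\<bar> < R"
      then have "R \<le> \<bar>z i\<bar>" by simp
      then have "R ^ (2 * m + 2) \<le> \<bar>z i\<bar> ^ (2 * m + 2)" using R1 by (intro power_mono) auto
      also have "\<dots> = z i ^ (2 * m + 2)" by (simp add: power_even_abs)
      also have "\<dots> \<le> V z" unfolding V_def
      proof (rule member_le_sum)
        show "0 \<le> z j ^ (2 * m + 2)" for j by (rule zero_le_even_power) simp
      qed (use that in simp_all)
      finally have "\<delta> * R ^ (2 * m + 2) \<le> \<delta> * V z" using \<delta> by simp
      moreover have "C * R ^ (2 * m) \<le> \<delta> * R\<^sup>2 * R ^ (2 * m)" using CR R1 by (intro mult_right_mono) auto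
      moreover have "P z * P z \<le> C * R ^ (2 * m)" using C(2)[OF R1, of z] z(1) by (auto simp: S_def)
      ultimately have "h z \<le> 0" by (simp add: h_def power_add mult_ac power2_eq_square)
      with hz show False by simp
    qed
    have "z i ^ Suc (2 * m) = q i z" if i: "i < n" for i
    proof -
      have "\<forall>\<^sub>F s in nhds (z i). 0 < sgn (p j a) * p j (z(i := s))" if "j \<in> J" for j
      proof -
        have "isCont (\<lambda>s. sgn (p j a) * p j (z(i := s))) (z i)"
          using contp[OF that i] by (intro continuous_intros)
        then have "((\<lambda>s. sgn (p j a) * p j (z(i := s))) \<longlongrightarrow> sgn (p j a) * p j z) (nhds (z i))"
          using tendsto_at_iff_tendsto_nhds[of "\<lambda>s. sgn (p j a) * p j (z(i := s))" "z i"]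
          by (simp add: isCont_def)
        then show ?thesis using sz[OF that] by (rule order_tendstoD)
      qed
      then have "\<forall>\<^sub>F s in nhds (z i). \<forall>j\<in>J. 0 < sgn (p j a) * p j (z(i := s))"
        using \<open>finite J\<close> by (simp add: eventually_ball_finite_distrib)
      moreover have "\<forall>\<^sub>F s in nhds (z i). \<bar>s\<bar> < R"
      proof -
        have "((\<lambda>s. \<bar>s\<bar>) \<longlongrightarrow> \<bar>z i\<bar>) (nhds (z i))" by (intro tendsto_intros filterlim_ident)
        then show ?thesis using zR[OF i] by (rule order_tendstoD)
      qed
      ultimately have "\<forall>\<^sub>F s in nhds (z i). z(i := s) \<in> S"
        by eventually_elim (use z(1) i in \<open>auto simp: S_def less_imp_le\<close>)
      then obtain d where d: "d > 0" "\<And>s. dist s (z i) < d \<Longrightarrow> z(i := s) \<in> S"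
        unfolding eventually_nhds_metric by blast
      have "h (z(i := s)) \<le> h (z(i := z i))" if "\<bar>z i - s\<bar> < d" for s
        using z(2)[OF d(2)[of s]] that by (simp add: dist_real_def abs_minus_commute)
      then have "g i z - \<delta> * ((2 * m + 2) * z i ^ (2 * m + 1)) = 0"
        using DERIV_local_max[OF h'[OF i, of z] d(1)] by blast
      moreover have "\<delta> * (2 * m + 2) \<noteq> 0" using \<delta>(1) by simp
      ultimately show ?thesis by (simp add: q_def eq_divide_eq mult_ac)
    qed
    moreover have "sgn (p j z) = sgn (p j a)" if "j \<in> J" for j
      using sz[OF that] by (auto simp: sgn_if zero_less_mult_iff split: if_splits)
    ultimately show ?thesis using z(1) by (intro exI[of _ z]) (auto simp: S_def)
  qed
  then obtain \<zeta> where \<zeta>: "\<And>a i. a \<in> A \<Longrightarrow> i < n \<Longrightarrow> \<zeta> a i ^ Suc (2 * m) = q i (\<zeta> a)"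
    "\<And>a i. a \<in> A \<Longrightarrow> i \<ge> n \<Longrightarrow> \<zeta> a i = 0" "\<And>a j. a \<in> A \<Longrightarrow> j \<in> J \<Longrightarrow> sgn (p j (\<zeta> a)) = sgn (p j a)"
    by metis
  \<comment> \<open>The critical point keeps the sign pattern of its cell, and the patterns of
    points of \<open>A\<close> are distinct.\<close>
  have "inj_on \<zeta> A"
  proof (intro inj_onI dist)
    fix a b j assume "a \<in> A" "b \<in> A" "\<zeta> a = \<zeta> b" "j \<in> J"
    then show "sgn (p j a) = sgn (p j b)" using \<zeta>(3)[of a j] \<zeta>(3)[of b j] by simp
  qed
  then have "card A = card (\<zeta> ` A)" by (simp add: card_image)
  also have "\<dots> \<le> Suc (2 * m) ^ n"
  proof (rule card_common_zeros_le)
    show "q i \<in> polyfun n (2 * m)" if "i < n" for i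
      unfolding q_def by (intro polyfun_cmult g that)
    show "\<exists>i<n. z i \<noteq> w i" if "z \<in> \<zeta> ` A" "w \<in> \<zeta> ` A" "z \<noteq> w" for z w
    proof -
      obtain i where "z i \<noteq> w i" using \<open>z \<noteq> w\<close> by blast
      moreover have "z i = 0 \<and> w i = 0" if "n \<le> i"
        using \<open>z \<in> \<zeta> ` A\<close> \<open>w \<in> \<zeta> ` A\<close> \<zeta>(2)[OF _ that] by auto
      ultimately show ?thesis by (intro exI[of _ i]) (auto simp: not_le[symmetric])
    qed
    show "z i ^ Suc (2 * m) = q i z" if "z \<in> \<zeta> ` A" "i < n" for z i
      using that \<zeta>(1) by blast
  qed (use \<open>finite A\<close> in simp)
  finally show ?thesis by (simp add: m_def)
qed

section \<open>Counting matrices of small sign rank\<close>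

text \<open>A maximal independent set \<open>U\<close> of columns spans the remaining ones. The
  vectors of \<open>U\<close> form the left factor, the coordinates of the columns the right
  one.\<close>

lemma (in vec_space) rank_factorization:
  assumes A: "A \<in> carrier_mat n nc"
  shows "\<exists>P Q. \<forall>i<n. \<forall>j<nc. A $$ (i, j) = (\<Sum>k<rank A. P i k * Q k j)"
proof -
  have cols: "set (cols A) \<subseteq> carrier_vec n" using cols_dim A by blast
  obtain U where U: "finite U" "maximal U (\<lambda>T. T \<subseteq> set (cols A) \<and> lin_indpt T)"
    using maximal_exists_superset[of "set (cols A)" "\<lambda>T. T \<subseteq> set (cols A) \<and> lin_indpt T" "{}"]
    by (auto simp: lin_dep_def)
  have rank: "rank A = card U" using rank_card_indpt[OF A U(2)] .
  have "lin_indpt U" and UA: "U \<subseteq> set (cols A)" using U(2) by (metis maximal_def)+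
  have UC: "U \<subseteq> carrier_vec n" using UA cols by blast
  have "v \<in> span U" if v: "v \<in> set (cols A)" for v
  proof (rule ccontr)
    assume nv: "v \<notin> span U"
    have "v \<in> carrier_vec n" using v cols by blast
    have "v \<notin> U" using nv span_mem[OF UC] by blast
    have "lin_indpt (U \<union> {v})"
      using lin_dep_iff_in_span[OF UC \<open>lin_indpt U\<close> \<open>v \<in> carrier_vec n\<close> \<open>v \<notin> U\<close>] nv by blast
    then have "U = U \<union> {v}" using U(2) v UA unfolding maximal_def by blast
    with \<open>v \<notin> U\<close> show False by blast
  qed
  then have "\<exists>a. col A j = lincomb a U" if "j < nc" for j
    using that A finite_in_span[OF U(1) UC] by (metis carrier_matD(2) cols_length cols_nth nth_mem)
  then obtain a where a: "\<And>j. j < nc \<Longrightarrow> col A j = lincomb (a j) U" by metis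
  obtain u where u: "bij_betw u {..<card U} U"
    using ex_bij_betw_nat_finite[OF U(1)] atLeast0LessThan by metis
  have eq: "A $$ (i, j) = (\<Sum>k<rank A. u k $ i * a j (u k))" if "i < n" "j < nc" for i j
  proof -
    have "A $$ (i, j) = col A j $ i" using that A by simp
    also have "\<dots> = (\<Sum>v\<in>U. a j v * v $ i)" using a[OF that(2)] lincomb_index[OF that(1) UC] by simp
    also have "\<dots> = (\<Sum>k<card U. a j (u k) * u k $ i)" 
      using sum.reindex_bij_betw[OF u, of "\<lambda>v. a j v * v $ i"] by simp
    finally show ?thesis by (simp add: rank mult.commute)
  qed
  show ?thesis
    by (rule exI[of _ "\<lambda>i k. u k $ i"], rule exI[of _ "\<lambda>k j. a j (u k)"]) (auto intro: eq)
qed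

lemma sign_matrix_sgn:
  assumes "S \<in> carrier_mat N N" "sign_matrix S"
  shows "0 \<notin> elements_mat S" "map_mat sgn S = S"
proof -
  have "S $$ (i, j) \<in> {-1, 1}" if "i < N" "j < N" for i j
    using assms that unfolding sign_matrix_def by blast
  then show "map_mat sgn S = S" using assms(1) by (intro eq_matI) force+
  show "0 \<notin> elements_mat S" using assms(2) unfolding sign_matrix_def by auto
qed

lemma sign_rank_witness:
  assumes "S \<in> carrier_mat N N" "sign_matrix S"
  obtains P Q where "\<And>i j. i < N \<Longrightarrow> j < N \<Longrightarrow> sgn (\<Sum>k<sign_rank S. P i k * Q k j) = S $$ (i, j)"
proof -
  let ?Q = "\<lambda>r. \<exists>M \<in> carrier_mat (dim_row S) (dim_col S).
     0 \<notin> elements_mat M \<and> map_mat sgn M = S \<and> vec_space.rank (dim_row S) M = r"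
  have "?Q (vec_space.rank (dim_row S) S)" using sign_matrix_sgn[OF assms] by blast
  then have "?Q (sign_rank S)" unfolding sign_rank_def by (rule LeastI)
  then obtain M where M: "M \<in> carrier_mat N N" "map_mat sgn M = S" "vec_space.rank N M = sign_rank S"
    using assms(1) by auto
  obtain P Q where PQ: "\<And>i j. i < N \<Longrightarrow> j < N \<Longrightarrow> M $$ (i, j) = (\<Sum>k<sign_rank S. P i k * Q k j)"
    using vec_space.rank_factorization[OF M(1)] M(3) by metis
  show thesis
  proof (rule that[of P Q])
    fix i j assume ij: "i < N" "j < N"
    then have "S $$ (i, j) = sgn (M $$ (i, j))" using M by auto
    then show "sgn (\<Sum>k<sign_rank S. P i k * Q k j) = S $$ (i, j)" using PQ[OF ij] by simp
  qed
qed

lemma sign_rank_le_dim: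
  assumes "S \<in> carrier_mat N N" "sign_matrix S"
  shows "sign_rank S \<le> N"
proof -
  have "sign_rank S \<le> vec_space.rank N S"
    unfolding sign_rank_def using sign_matrix_sgn[OF assms] assms(1) by (intro Least_le) auto
  also have "\<dots> \<le> N" using assms(1) by (rule vec_space.rank_le_nc)
  finally show ?thesis .
qed

lemma card_sign_rank_le:
  assumes "finite F"
    and F: "\<And>S. S \<in> F \<Longrightarrow> S \<in> carrier_mat N N \<and> sign_matrix S \<and> sign_rank S \<le> r"
  shows "card F \<le> Suc (4 * N\<^sup>2) ^ (2 * N * r)"
proof -
  \<comment> \<open>The first \<open>N * r\<close> variables hold the left factor row by row, the
    next \<open>N * r\<close> the right factor column by column.\<close>
  define p where "p = (\<lambda>(i, j) x. \<Sum>k<r. x (i * r + k) * x (N * r + (j * r + k)) :: real)"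
  have less: "i * r + k < N * r" if "i < N" "k < r" for i k
    using that mult_le_mono1[of "Suc i" N r] by auto
  have "\<exists>x. \<forall>i<N. \<forall>j<N. sgn (p (i, j) x) = S $$ (i, j)" if S: "S \<in> F" for S
  proof -
    let ?s = "sign_rank S"
    obtain P Q where PQ: "\<And>i j. i < N \<Longrightarrow> j < N \<Longrightarrow> sgn (\<Sum>k<?s. P i k * Q k j) = S $$ (i, j)"
      using sign_rank_witness[of S N] F[OF S] by blast
    \<comment> \<open>Zeros in the left factor widen a factorization of width
      \<open>?s \<le> r\<close> to width \<open>r\<close>, so that one family of polynomials serves
      all matrices.\<close>
    define x where "x = (\<lambda>m. if m < N * r
      then (if m mod r < ?s then P (m div r) (m mod r) else 0)
      else Q ((m - N * r) mod r) ((m - N * r) div r))"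
    have "p (i, j) x = (\<Sum>k<?s. P i k * Q k j)" if "i < N" "j < N" for i j
    proof -
      have "p (i, j) x = (\<Sum>k<r. (if k < ?s then P i k else 0) * Q k j)"
        unfolding p_def prod.case by (intro sum.cong) (auto simp: x_def less that)
      also have "\<dots> = (\<Sum>k<?s. (if k < ?s then P i k else 0) * Q k j)"
        using F[OF S] by (intro sum.mono_neutral_right) auto
      finally show ?thesis by simp
    qed
    then show ?thesis using PQ by (intro exI[of _ x] allI impI) simp
  qed
  then obtain x where x: "\<And>S i j. S \<in> F \<Longrightarrow> i < N \<Longrightarrow> j < N \<Longrightarrow> sgn (p (i, j) (x S)) = S $$ (i, j)"
    using bchoice[of F "\<lambda>S x. \<forall>i<N. \<forall>j<N. sgn (p (i, j) x) = S $$ (i, j)"] by blast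
  have dist: "S = T" if "S \<in> F" "T \<in> F" 
    and eq: "\<And>ij. ij \<in> {..<N} \<times> {..<N} \<Longrightarrow> sgn (p ij (x S)) = sgn (p ij (x T))" for S T
  proof -
    have "S $$ (i, j) = T $$ (i, j)" if "i < N" "j < N" for i j
      using eq[of "(i, j)"] x that \<open>S \<in> F\<close> \<open>T \<in> F\<close> by simp
    then show ?thesis using F[OF \<open>S \<in> F\<close>] F[OF \<open>T \<in> F\<close>] by (intro eq_matI) auto
  qed
  then have "inj_on x F" by (intro inj_onI) auto
  then have "card F = card (x ` F)" by (simp add: card_image)
  also have "\<dots> \<le> Suc (2 * (card ({..<N} \<times> {..<N}) * 2)) ^ (2 * N * r)"
  proof (rule card_sign_patterns_le[where p = p])
    show "p ij \<in> polyfun (2 * N * r) 2" if "ij \<in> {..<N} \<times> {..<N}" for ij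
    proof -
      have "(\<lambda>x. x (i * r + k) * x (N * r + (j * r + k))) \<in> polyfun (2 * N * r) (1 + 1)"
        if "i < N" "j < N" "k < r" for i j k
        using less[of i k] less[of j k] that by (intro polyfun_mult polyfun_var) auto
      then show ?thesis using that by (auto simp: p_def numeral_2_eq_2 intro!: polyfun_sum)
    qed
    show "p ij a \<noteq> 0" if "a \<in> x ` F" and ij: "ij \<in> {..<N} \<times> {..<N}" for a ij
    proof -
      obtain i j S where *: "ij = (i, j)" "i < N" "j < N" "S \<in> F" "a = x S"
        using \<open>a \<in> x ` F\<close> ij by auto
      then have "S $$ (i, j) \<in> {-1, 1}" using F[of S] unfolding sign_matrix_def by blast
      then show ?thesis using x[of S i j] * by (auto simp: sgn_if split: if_splits)
    qed
  qed (use \<open>finite F\<close> dist in auto)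
  finally show ?thesis by (simp add: power2_eq_square mult.assoc)
qed

section \<open>Matrices of prescribed VC dimension\<close>

text \<open>If the columns \<open>c 0, \<dots>, c d\<close> are shattered, then for every \<open>t \<subseteq> {..d}\<close> some row \<open>\<rho> t\<close> has its
  positive entries exactly at the \<open>c j\<close> with \<open>j \<in> t\<close>. The family \<open>T\<close> selects the part of this
  configuration that is forbidden; being monotone, the condition passes to all subgraphs.\<close>

definition has_pattern :: "nat set set \<Rightarrow> nat \<Rightarrow> nat \<Rightarrow> (nat \<times> nat) set \<Rightarrow> bool" where
  "has_pattern T d n G \<longleftrightarrow> (\<exists>\<rho> c. \<rho> \<in> T \<rightarrow> {..<n} \<and> c \<in> {..d} \<rightarrow> {..<n} \<and> inj_on \<rho> T \<and> inj_on c {..d} \<and>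
     (\<forall>t\<in>T. \<forall>j\<in>t. (\<rho> t, c j) \<in> G))"

lemma has_pattern_mono: "has_pattern T d n G \<Longrightarrow> G \<subseteq> G' \<Longrightarrow> has_pattern T d n G'"
  unfolding has_pattern_def by (meson subsetD)

text \<open>The block with rows \<open>\<beta> i\<close> raises the VC dimension to \<open>d\<close>, since the pattern-free part alone only
  has VC dimension at most \<open>d\<close>.\<close>

definition padded_mat :: "(nat \<Rightarrow> nat set) \<Rightarrow> nat \<Rightarrow> nat \<Rightarrow> (nat \<times> nat) set \<Rightarrow> real mat" where
  "padded_mat \<beta> d n G = mat (n + 2 ^ d) (n + 2 ^ d) (\<lambda>(i, j).
     if i < n \<and> j < n \<and> (i, j) \<in> G \<or> n \<le> i \<and> n \<le> j \<and> j - n \<in> \<beta> (i - n) then 1 else -1)"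

lemma padded_mat_carrier: "padded_mat \<beta> d n G \<in> carrier_mat (n + 2 ^ d) (n + 2 ^ d)"
  by (simp add: padded_mat_def)

lemma sign_matrix_padded_mat: "sign_matrix (padded_mat \<beta> d n G)"
  unfolding sign_matrix_def
proof
  fix x assume "x \<in> elements_mat (padded_mat \<beta> d n G)"
  then obtain i j where "i < n + 2 ^ d" "j < n + 2 ^ d" "x = padded_mat \<beta> d n G $$ (i, j)"
    using padded_mat_carrier by (metis carrier_matD elements_matD)
  then show "x \<in> {-1, 1}" by (simp add: padded_mat_def)
qed

section \<open>VC dimension of the padded matrices\<close>

lemma shatteredD:
  "shattered S C \<Longrightarrow> p \<in> C \<rightarrow> {-1, 1} \<Longrightarrow> \<exists>i<dim_row S. \<forall>j\<in>C. S $$ (i, j) = p j"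
  by (simp add: shattered_def)

lemma shattered_subset:
  assumes "shattered S C" "D \<subseteq> C"
  shows "shattered S D"
  unfolding shattered_def
proof (intro conjI ballI)
  show "D \<subseteq> {..<dim_col S}" using assms by (auto simp: shattered_def)
  fix p :: "nat \<Rightarrow> real" assume "p \<in> D \<rightarrow> {-1, 1}"
  then have "(\<lambda>j. if j \<in> D then p j else 1) \<in> C \<rightarrow> {-1, 1}" unfolding Pi_iff by auto
  from shatteredD[OF assms(1) this]
  obtain i where "i < dim_row S" "\<forall>j\<in>C. S $$ (i, j) = (if j \<in> D then p j else 1)" by blast
  then show "\<exists>i<dim_row S. \<forall>j\<in>D. S $$ (i, j) = p j"
    using assms(2) by (intro exI[of _ i]) auto
qed

text \<open>A shattered set of \<open>d + 1\<close> columns has an all-positive row, and the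
  positive entries of a row lie in one diagonal block, so the set does too. The second block is
  square of size \<open>2 ^ d\<close>, but only its first \<open>d\<close> columns have positive
  entries. Hence the set lies in the first block; a row \<open>\<rho> t\<close> with
  \<open>t \<in> T\<close> has a positive entry there, as \<open>t\<close> is nonempty, and these
  rows form the pattern.\<close>

lemma VC_dim_padded_mat:
  assumes \<beta>: "bij_betw \<beta> {..<2 ^ d} (Pow {..<d})"
    and T: "T \<subseteq> Pow {..d}" "{} \<notin> T" and G: "\<not> has_pattern T d n G"
  shows "VC_dim (padded_mat \<beta> d n G) = d"
proof -
  define S where "S = padded_mat \<beta> d n G"
  define N where "N = n + 2 ^ d"
  have dim: "dim_row S = N" "dim_col S = N" by (simp_all add: S_def N_def padded_mat_def)
  have S1: "S $$ (i, j) = 1 \<longleftrightarrow> i < n \<and> j < n \<and> (i, j) \<in> G \<or> n \<le> i \<and> n \<le> j \<and> j - n \<in> \<beta> (i - n)"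
    if "i < N" "j < N" for i j
    using that by (auto simp: S_def N_def padded_mat_def)
  have \<beta>d: "\<beta> i \<subseteq> {..<d}" if "i < 2 ^ d" for i
    using \<beta> that by (auto simp: bij_betw_def)
  have upper: "card C \<le> d" if C: "shattered S C" for C
  proof (rule ccontr)
    assume "\<not> card C \<le> d"
    then obtain D where D: "D \<subseteq> C" "card D = Suc d"
      by (meson not_less_eq_eq obtain_subset_with_card_n)
    then have DS: "shattered S D" using shattered_subset C by blast
    have "finite D" using D(2) by (metis card.infinite nat.distinct(1))
    then obtain c where c: "bij_betw c {..d} D"
      using ex_bij_betw_nat_finite[of D] D(2) by (metis atLeast0LessThan lessThan_Suc_atMost)
    have DN: "D \<subseteq> {..<N}" using DS dim by (simp add: shattered_def)
    have "\<exists>i<N. \<forall>y\<in>D. S $$ (i, y) = 1 \<longleftrightarrow> y \<in> c ` t" for t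
    proof -
      have "(\<lambda>y. if y \<in> c ` t then 1 else -1 :: real) \<in> D \<rightarrow> {-1, 1}" by auto
      from shatteredD[OF DS this]
      obtain i where "i < N" "\<forall>y\<in>D. S $$ (i, y) = (if y \<in> c ` t then 1 else -1)"
        using dim by auto
      then show ?thesis by (intro exI[of _ i]) auto
    qed
    then obtain \<rho> where \<rho>: "\<And>t. \<rho> t < N" "\<And>t y. y \<in> D \<Longrightarrow> S $$ (\<rho> t, y) = 1 \<longleftrightarrow> y \<in> c ` t" by metis
    have one: "S $$ (\<rho> {..d}, y) = 1" if "y \<in> D" for y
      using \<rho>(2)[OF that] c that by (simp add: bij_betw_def)
    have Dn: "D \<subseteq> {..<n}"
    proof (cases "\<rho> {..d} < n")
      case True
      then show ?thesis using one S1[OF \<rho>(1)] DN by fastforce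
    next
      case False
      have "D \<subseteq> {n..<n+d}"
      proof
        fix y assume y: "y \<in> D"
        then have *: "n \<le> y" "y - n \<in> \<beta> (\<rho> {..d} - n)" 
          using one[OF y] S1[OF \<rho>(1), of y "{..d}"] DN False by auto
        moreover have "\<rho> {..d} - n < 2 ^ d" using \<rho>(1)[of "{..d}"] False by (simp add: N_def)
        ultimately have "y - n < d" using \<beta>d by blast
        with * show "y \<in> {n..<n+d}" by auto
      qed
      then have "card D \<le> card {n..<n+d}" by (intro card_mono) auto
      with D(2) show ?thesis by simp
    qed
    have cD: "c j \<in> D" if "j \<le> d" for j using c that by (auto simp: bij_betw_def)
    have edge: "\<rho> t < n \<and> (\<rho> t, c j) \<in> G" if "t \<in> T" "j \<in> t" for t j
    proof -
      have "c j \<in> D" using cD that T(1) by auto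
      moreover from this have "c j < n" "c j < N" using Dn DN by auto
      moreover have "S $$ (\<rho> t, c j) = 1" using \<rho>(2) \<open>c j \<in> D\<close> that by blast
      ultimately show ?thesis using S1[OF \<rho>(1)[of t], of "c j"] by auto
    qed
    have "inj_on \<rho> T"
    proof (rule inj_onI)
      fix s t assume st: "s \<in> T" "t \<in> T" "\<rho> s = \<rho> t"
      then have sub: "s \<subseteq> {..d}" "t \<subseteq> {..d}" using T by auto
      then have "c ` s \<subseteq> D" "c ` t \<subseteq> D" using cD by auto
      then have "c ` s = c ` t" using \<rho>(2) st(3) by (metis subset_antisym subsetD subsetI)
      then show "s = t" using c sub by (metis bij_betw_imp_inj_on inj_on_image_eq_iff)
    qed
    moreover have "\<rho> \<in> T \<rightarrow> {..<n}" using edge T(2) by (metis Pi_I ex_in_conv lessThan_iff)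
    moreover have "c \<in> {..d} \<rightarrow> {..<n}" using cD Dn by auto
    moreover have "inj_on c {..d}" using c by (simp add: bij_betw_def)
    ultimately have "has_pattern T d n G" unfolding has_pattern_def using edge by blast
    with G show False by blast
  qed
  have "shattered S {n..<n+d}"
    unfolding shattered_def
  proof (intro conjI ballI)
    have "n + d \<le> N" by (simp add: N_def less_imp_le)
    then show sub: "{n..<n+d} \<subseteq> {..<dim_col S}" using dim by auto
    fix p :: "nat \<Rightarrow> real" assume p: "p \<in> {n..<n+d} \<rightarrow> {-1, 1}"
    define s where "s = {j. j < d \<and> p (n + j) = 1}"
    have "s \<in> \<beta> ` {..<2 ^ d}"
      unfolding bij_betw_imp_surj_on[OF \<beta>] by (auto simp: s_def)
    then obtain i where i: "s = \<beta> i" "i < 2 ^ d" unfolding image_iff by blast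
    have "S $$ (n + i, y) = p y" if y: "y \<in> {n..<n+d}" for y
    proof -
      have yN: "y < N" using y \<open>n + d \<le> N\<close> by simp
      have iN: "n + i < N" using i(2) by (simp add: N_def)
      have "S $$ (n + i, y) = 1 \<longleftrightarrow> y - n \<in> s"
        using S1[OF iN yN] y by (simp add: i(1))
      also have "\<dots> \<longleftrightarrow> p y = 1" using y by (auto simp: s_def)
      finally have "S $$ (n + i, y) = 1 \<longleftrightarrow> p y = 1" .
      moreover have "S $$ (n + i, y) \<in> {-1, 1}"
        using yN iN unfolding S_def N_def padded_mat_def by simp
      moreover have "p y \<in> {-1, 1}" using p y unfolding Pi_iff by blast
      ultimately show ?thesis by (elim insertE emptyE) simp_all
    qed
    then show "\<exists>i<dim_row S. \<forall>j\<in>{n..<n+d}. S $$ (i, j) = p j"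
      using i(2) dim by (intro exI[of _ "n + i"]) (auto simp: N_def)
  qed
  moreover have "finite {card C |C. shattered S C}"
    by (rule finite_subset[of _ "{..d}"]) (use upper in auto)
  ultimately have "Max {card C |C. shattered S C} = d"
    using upper by (intro Max_eqI) (auto intro!: exI[of _ "{n..<n+d}"])
  then show ?thesis by (simp add: VC_dim_def S_def)
qed

lemma two_power_card_le:
  assumes "G \<subseteq> {..<n} \<times> {..<n}" "\<not> has_pattern T d n G" "T \<subseteq> Pow {..d}" "{} \<notin> T"
    and N: "N = n + 2 ^ d"
  shows "2 ^ card G \<le> Suc (4 * N\<^sup>2) ^ (2 * N * max_sign_rank N d)"
proof -
  have "finite G" using assms(1) by (rule finite_subset) auto
  obtain \<beta> :: "nat \<Rightarrow> nat set" where \<beta>: "bij_betw \<beta> {..<2 ^ d} (Pow {..<d})"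
    using ex_bij_betw_nat_finite[of "Pow {..<d}"] by (auto simp: card_Pow atLeast0LessThan)
  define F where "F = padded_mat \<beta> d n ` Pow G"
  have "inj_on (padded_mat \<beta> d n) (Pow G)"
  proof (rule inj_onI)
    fix A B assume AB: "A \<in> Pow G" "B \<in> Pow G" "padded_mat \<beta> d n A = padded_mat \<beta> d n B"
    have sub: "A \<subseteq> {..<n} \<times> {..<n}" "B \<subseteq> {..<n} \<times> {..<n}" using AB assms(1) by auto
    have "(i, j) \<in> A \<longleftrightarrow> (i, j) \<in> B" if "i < n" "j < n" for i j
    proof -
      have "padded_mat \<beta> d n A $$ (i, j) = padded_mat \<beta> d n B $$ (i, j)" using AB(3) by simp
      then show ?thesis using that by (auto simp: padded_mat_def split: if_splits)
    qed
    with sub show "A = B" by auto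
  qed
  then have "card F = 2 ^ card G" using \<open>finite G\<close> by (simp add: F_def card_image card_Pow)
  moreover have "card F \<le> Suc (4 * N\<^sup>2) ^ (2 * N * max_sign_rank N d)"
  proof (rule card_sign_rank_le)
    show "finite F" using \<open>finite G\<close> by (simp add: F_def)
    fix S assume "S \<in> F"
    then obtain A where A: "A \<subseteq> G" "S = padded_mat \<beta> d n A" by (auto simp: F_def)
    have S: "S \<in> carrier_mat N N" "sign_matrix S"
      using A padded_mat_carrier sign_matrix_padded_mat by (auto simp: N)
    have "VC_dim S = d" unfolding A(2)
      by (rule VC_dim_padded_mat[OF \<beta> assms(3,4)]) (use has_pattern_mono A(1) assms(2) in blast)
    have "finite {sign_rank S |S. S \<in> carrier_mat N N \<and> sign_matrix S \<and> VC_dim S = d}"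
      by (rule finite_subset[of _ "{..N}"]) (auto intro: sign_rank_le_dim)
    then have "sign_rank S \<le> max_sign_rank N d"
      unfolding max_sign_rank_def using S \<open>VC_dim S = d\<close> by (intro Max_ge) blast+
    with S show "S \<in> carrier_mat N N \<and> sign_matrix S \<and> sign_rank S \<le> max_sign_rank N d" by blast
  qed
  ultimately show ?thesis by simp
qed

section \<open>Pattern-free graphs by deletion\<close>

text \<open>The probability that a random subset of \<open>U\<close>, keeping each element
  independently with probability \<open>\<pi>\<close>, contains \<open>A\<close>. It is the
  expansion of a product over \<open>U\<close> in which the factor 0 on \<open>A\<close> removes the
  sets missing an element of \<open>A\<close>.\<close>

lemma sum_bernoulli_weight_superset:
  fixes \<pi> :: real
  assumes "finite U" "A \<subseteq> U"
  shows "(\<Sum>G\<in>Pow U. if A \<subseteq> G then \<pi> ^ card G * (1 - \<pi>) ^ card (U - G) else 0) = \<pi> ^ card A"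
proof -
  have "(\<Sum>G\<in>Pow U. if A \<subseteq> G then \<pi> ^ card G * (1 - \<pi>) ^ card (U - G) else 0)
      = (\<Sum>G\<in>Pow U. (\<Prod>x\<in>G. \<pi>) * (\<Prod>x\<in>U - G. if x \<in> A then 0 else 1 - \<pi>))"
  proof (rule sum.cong)
    fix G assume "G \<in> Pow U"
    show "(if A \<subseteq> G then \<pi> ^ card G * (1 - \<pi>) ^ card (U - G) else 0)
      = (\<Prod>x\<in>G. \<pi>) * (\<Prod>x\<in>U - G. if x \<in> A then 0 else 1 - \<pi>)"
    proof (cases "A \<subseteq> G")
      case True
      then have "(\<Prod>x\<in>U - G. if x \<in> A then 0 else 1 - \<pi>) = (\<Prod>x\<in>U - G. 1 - \<pi>)"
        by (intro prod.cong) auto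
      with True show ?thesis by simp
    next
      case False
      then obtain x where "x \<in> U - G" "x \<in> A" using assms(2) by blast
      then have "(\<Prod>x\<in>U - G. if x \<in> A then 0 else 1 - \<pi>) = 0"
        using assms(1) by (intro prod_zero) auto
      with False show ?thesis by simp
    qed
  qed simp
  also have "\<dots> = (\<Prod>x\<in>U. \<pi> + (if x \<in> A then 0 else 1 - \<pi>))"
    using assms(1) by (rule prod_add[symmetric])
  also have "\<dots> = (\<Prod>x\<in>U. if x \<in> A then \<pi> else 1)" by (intro prod.cong) auto
  also have "\<dots> = \<pi> ^ card A"
    using assms by (simp add: prod.If_cases Int_absorb1)
  finally show ?thesis .
qed

text \<open>For a random \<open>G\<close> the expectation of \<open>card G\<close> minus the number
  of members of \<open>H\<close> inside \<open>G\<close> is the stated bound. Some \<open>G\<close>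
  attains it, and deleting one element from each such member destroys them all.\<close>

lemma deletion_method:
  fixes \<pi> :: real
  assumes "finite U" "finite H" and H: "\<And>h. h \<in> H \<Longrightarrow> h \<subseteq> U \<and> card h = e" and "e > 0"
    and \<pi>: "0 \<le> \<pi>" "\<pi> \<le> 1"
  shows "\<exists>G\<subseteq>U. (\<forall>h\<in>H. \<not> h \<subseteq> G) \<and> \<pi> * card U - card H * \<pi> ^ e \<le> card G"
proof -
  define w where "w = (\<lambda>G. \<pi> ^ card G * (1 - \<pi>) ^ card (U - G))"
  define bad where "bad = (\<lambda>G. {h \<in> H. h \<subseteq> G})"
  define \<mu> where "\<mu> = \<pi> * card U - card H * \<pi> ^ e"
  have w: "(\<Sum>G\<in>Pow U. if A \<subseteq> G then w G else 0) = \<pi> ^ card A" if "A \<subseteq> U" for A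
    unfolding w_def by (rule sum_bernoulli_weight_superset[OF assms(1) that])
  have w1: "(\<Sum>G\<in>Pow U. w G) = 1" using w[of "{}"] by simp
  have w0: "w G \<ge> 0" for G using \<pi> by (simp add: w_def)
  have card_eq: "(\<Sum>G\<in>Pow U. w G * card G) = \<pi> * card U"
  proof -
    have "w G * card G = (\<Sum>x\<in>U. if {x} \<subseteq> G then w G else 0)" if "G \<in> Pow U" for G
    proof -
      have "U \<inter> G = G" using that by auto
      then show ?thesis using assms(1) by (simp add: sum.If_cases Int_def[symmetric] mult.commute)
    qed
    then have "(\<Sum>G\<in>Pow U. w G * card G) = (\<Sum>G\<in>Pow U. \<Sum>x\<in>U. if {x} \<subseteq> G then w G else 0)"
      by (intro sum.cong) auto
    also have "\<dots> = (\<Sum>x\<in>U. \<Sum>G\<in>Pow U. if {x} \<subseteq> G then w G else 0)" by (rule sum.swap)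
    also have "\<dots> = (\<Sum>x\<in>U. \<pi>)"
    proof (rule sum.cong)
      fix x assume "x \<in> U"
      then show "(\<Sum>G\<in>Pow U. if {x} \<subseteq> G then w G else 0) = \<pi>" using w[of "{x}"] by simp
    qed simp
    finally show ?thesis by simp
  qed
  have bad_eq: "(\<Sum>G\<in>Pow U. w G * card (bad G)) = card H * \<pi> ^ e"
  proof -
    have "w G * card (bad G) = (\<Sum>h\<in>H. if h \<subseteq> G then w G else 0)" for G
      using assms(2) by (simp add: sum.If_cases bad_def Collect_conj_eq mult.commute)
    then have "(\<Sum>G\<in>Pow U. w G * card (bad G)) = (\<Sum>G\<in>Pow U. \<Sum>h\<in>H. if h \<subseteq> G then w G else 0)"
      by simp
    also have "\<dots> = (\<Sum>h\<in>H. \<Sum>G\<in>Pow U. if h \<subseteq> G then w G else 0)" by (rule sum.swap)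
    also have "\<dots> = (\<Sum>h\<in>H. \<pi> ^ e)"
    proof (rule sum.cong)
      fix h assume "h \<in> H"
      then show "(\<Sum>G\<in>Pow U. if h \<subseteq> G then w G else 0) = \<pi> ^ e" using w[of h] H by simp
    qed simp
    finally show ?thesis by simp
  qed
  have "\<exists>G\<in>Pow U. \<mu> \<le> card G - real (card (bad G))"
  proof (rule ccontr)
    assume "\<not> (\<exists>G\<in>Pow U. \<mu> \<le> card G - real (card (bad G)))"
    then have less: "card G - real (card (bad G)) < \<mu>" if "G \<in> Pow U" for G
      using that by (meson not_le)
    have "(\<Sum>G\<in>Pow U. w G * (\<mu> - (card G - real (card (bad G))))) = 0"
    proof -
      have "(\<Sum>G\<in>Pow U. w G * (\<mu> - (card G - real (card (bad G)))))
          = (\<Sum>G\<in>Pow U. \<mu> * w G) - (\<Sum>G\<in>Pow U. w G * card G) + (\<Sum>G\<in>Pow U. w G * card (bad G))"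
        by (simp add: algebra_simps sum.distrib sum_subtractf)
      then show ?thesis by (simp add: card_eq bad_eq w1 \<mu>_def sum_distrib_left[symmetric])
    qed
    moreover have "w G * (\<mu> - (card G - real (card (bad G)))) \<ge> 0" if "G \<in> Pow U" for G
      using w0 less[OF that] by (intro mult_nonneg_nonneg) auto
    ultimately have *: "w G * (\<mu> - (card G - real (card (bad G)))) = 0" if "G \<in> Pow U" for G
      using that assms(1) sum_nonneg_eq_0_iff[of "Pow U" "\<lambda>G. w G * (\<mu> - (card G - real (card (bad G))))"]
      by simp
    have "w G = 0" if "G \<in> Pow U" for G using less[OF that] *[OF that] unfolding mult_eq_0_iff by linarith
    then have "(\<Sum>G\<in>Pow U. w G) = 0" by (intro sum.neutral) auto
    with w1 show False by simp
  qed
  then obtain G where G: "G \<subseteq> U" "\<mu> \<le> card G - real (card (bad G))" by auto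
  define pick where "pick = (\<lambda>h::'a set. SOME x. x \<in> h)"
  have pick: "pick h \<in> h" if "h \<in> H" for h
    using H[OF that] \<open>e > 0\<close> unfolding pick_def by (metis card.empty ex_in_conv less_irrefl someI)
  define G' where "G' = G - pick ` bad G"
  have "finite (bad G)" using assms(2) by (simp add: bad_def)
  have "card G - card (bad G) \<le> card G - card (pick ` bad G)"
    using card_image_le[OF \<open>finite (bad G)\<close>, of pick] by (rule diff_le_mono2)
  also have "\<dots> \<le> card G'" unfolding G'_def using \<open>finite (bad G)\<close> by (intro diff_card_le_card_Diff) auto
  finally have "card G - real (card (bad G)) \<le> card G'" by linarith
  moreover have "\<not> h \<subseteq> G'" if "h \<in> H" for h
    using pick[OF that] that by (auto simp: G'_def bad_def)
  ultimately show ?thesis using G by (intro exI[of _ G']) (auto simp: G'_def \<mu>_def)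
qed

text \<open>The forbidden configuration has \<open>v = d + 1 + card T\<close> vertices and \<open>e\<close> edges, so edge density
  \<open>n powr -(v - 2) / (e - 1) / 2\<close> makes the expected number of copies at most half the expected
  number of edges.\<close>

lemma exists_large_pattern_free:
  assumes T: "T \<subseteq> Pow {..d}" and e: "e = (\<Sum>t\<in>T. card t)" "e \<ge> 2" and "n \<ge> 1" and "T \<noteq> {}"
    and a: "a = (real (d + card T) - 1) / (real e - 1)"
  shows "\<exists>G\<subseteq>{..<n} \<times> {..<n}. \<not> has_pattern T d n G \<and> real n powr (2 - a) / 4 \<le> card G"
proof -
  define \<pi> where "\<pi> = real n powr (-a) / 2"
  define edges where "edges = (\<lambda>(\<rho> :: nat set \<Rightarrow> nat, c :: nat \<Rightarrow> nat). (\<lambda>(t, j). (\<rho> t, c j)) ` (SIGMA t:T. t))"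
  define I where "I = {(\<rho>, c) \<in> (T \<rightarrow>\<^sub>E {..<n}) \<times> ({..d} \<rightarrow>\<^sub>E {..<n}). inj_on \<rho> T \<and> inj_on c {..d}}"
  have finT: "finite T" using T by (rule finite_subset) auto
  have fint: "finite t" if "t \<in> T" for t using T that by (meson PowD finite_atMost finite_subset subsetD)
  have finI: "finite ((T \<rightarrow>\<^sub>E {..<n}) \<times> ({..d} \<rightarrow>\<^sub>E {..<n}))" using finT by (simp add: finite_PiE)
  then have "finite I" by (rule finite_subset[rotated]) (auto simp: I_def)
  have "card I \<le> card ((T \<rightarrow>\<^sub>E {..<n}) \<times> ({..d} \<rightarrow>\<^sub>E {..<n}))"
    by (rule card_mono[OF finI]) (auto simp: I_def)
  also have "\<dots> = n ^ (d + card T + 1)"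
    using finT by (simp add: card_cartesian_product card_PiE power_add mult_ac)
  finally have cardH: "card (edges ` I) \<le> n ^ (d + card T + 1)"
    using card_image_le[OF \<open>finite I\<close>, of edges] by linarith
  have "d + card T \<ge> 1" using \<open>T \<noteq> {}\<close> finT by (simp add: Suc_le_eq card_gt_0_iff)
  then have a0: "a \<ge> 0" unfolding a using e(2) by (intro divide_nonneg_nonneg) auto
  have \<pi>01: "0 \<le> \<pi>" "\<pi> \<le> 1"
    using powr_mono[of "-a" 0 "real n"] a0 \<open>n \<ge> 1\<close> by (auto simp: \<pi>_def)
  have edges: "h \<subseteq> {..<n} \<times> {..<n} \<and> card h = e" if h: "h \<in> edges ` I" for h
  proof -
    obtain \<rho> c where \<rho>c: "\<rho> \<in> T \<rightarrow>\<^sub>E {..<n}" "c \<in> {..d} \<rightarrow>\<^sub>E {..<n}" "inj_on \<rho> T" "inj_on c {..d}"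
      "h = (\<lambda>(t, j). (\<rho> t, c j)) ` (SIGMA t:T. t)"
      using h by (auto simp: I_def edges_def)
    have "inj_on (\<lambda>(t, j). (\<rho> t, c j)) (SIGMA t:T. t)"
    proof (rule inj_onI)
      fix x y assume xy: "x \<in> (SIGMA t:T. t)" "y \<in> (SIGMA t:T. t)"
        "(\<lambda>(t, j). (\<rho> t, c j)) x = (\<lambda>(t, j). (\<rho> t, c j)) y"
      then have "fst x \<in> T" "fst y \<in> T" "\<rho> (fst x) = \<rho> (fst y)" "c (snd x) = c (snd y)"
        "snd x \<in> {..d}" "snd y \<in> {..d}" using T by fastforce+
      then show "x = y" using \<rho>c(3,4) by (metis inj_onD prod_eq_iff)
    qed
    then have "card h = card (SIGMA t:T. t)" using \<rho>c(5) by (simp add: card_image)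
    also have "\<dots> = e" using finT fint e by simp
    finally show ?thesis using \<rho>c(1,2,5) T by (fastforce simp: PiE_def Pi_def)
  qed
  have "\<exists>G\<subseteq>{..<n} \<times> {..<n}. (\<forall>h\<in>edges ` I. \<not> h \<subseteq> G) \<and>
      \<pi> * card ({..<n} \<times> {..<n}) - card (edges ` I) * \<pi> ^ e \<le> card G"
    by (rule deletion_method[OF _ _ edges _ \<pi>01]) (use \<open>finite I\<close> e(2) in simp_all)
  then obtain G where G: "G \<subseteq> {..<n} \<times> {..<n}" "\<forall>h\<in>edges ` I. \<not> h \<subseteq> G"
    "\<pi> * card ({..<n} \<times> {..<n}) - card (edges ` I) * \<pi> ^ e \<le> card G" by (elim exE conjE)
  have "\<not> has_pattern T d n G"
  proof
    assume "has_pattern T d n G"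
    then obtain \<rho> c where \<rho>c: "\<rho> \<in> T \<rightarrow> {..<n}" "c \<in> {..d} \<rightarrow> {..<n}" "inj_on \<rho> T" "inj_on c {..d}"
      "\<forall>t\<in>T. \<forall>j\<in>t. (\<rho> t, c j) \<in> G" unfolding has_pattern_def by blast
    have "(restrict \<rho> T, restrict c {..d}) \<in> I"
      using \<rho>c(1-4) by (auto simp: I_def inj_on_restrict_eq)
    moreover have "edges (restrict \<rho> T, restrict c {..d}) \<subseteq> G"
      using \<rho>c(5) T by (fastforce simp: edges_def)
    ultimately show False using G(2) by blast
  qed
  moreover have "real n powr (2 - a) / 4 \<le> card G"
  proof -
    have n0: "real n > 0" using \<open>n \<ge> 1\<close> by simp
    \<comment> \<open>Here \<open>v\<close> is the number of vertices minus 2, the exponent of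
      \<open>n\<close> left once the \<open>n\<^sup>2\<close> possible edges are split off.\<close>
    define v where "v = d + card T - 1"
    have v: "d + card T + 1 = 2 + v" "real v = real (d + card T) - 1"
      using \<open>d + card T \<ge> 1\<close> by (auto simp: v_def)
    have "\<pi> ^ (e - 1) = (real n powr (-a)) ^ (e - 1) / 2 ^ (e - 1)" by (simp add: \<pi>_def power_divide)
    also have "(real n powr (-a)) ^ (e - 1) = real n powr (- a * real (e - 1))"
      using n0 by (simp add: powr_realpow[symmetric] powr_powr)
    also have "- a * real (e - 1) = - real v"
      using e(2) by (simp add: a v of_nat_diff)
    also have "real n powr (- real v) = 1 / real n ^ v" using n0 by (simp add: powr_minus powr_realpow field_simps)
    finally have "\<pi> ^ (e - 1) * real n ^ v = 1 / 2 ^ (e - 1)" using n0 by simp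
    also have "\<dots> \<le> 1 / 2 ^ 1" using e(2) by (intro divide_left_mono power_increasing) auto
    finally have half: "\<pi> ^ (e - 1) * real n ^ v \<le> 1 / 2" by simp
    have "real (card (edges ` I)) \<le> real n ^ (2 + v)"
      using cardH unfolding v(1) by (metis of_nat_le_iff of_nat_power)
    then have "real (card (edges ` I)) * \<pi> ^ e \<le> real n ^ (2 + v) * \<pi> ^ e"
      using \<pi>01 by (intro mult_right_mono) auto
    also have "real n ^ (2 + v) * \<pi> ^ e = (\<pi> * real n ^ 2) * (\<pi> ^ (e - 1) * real n ^ v)"
      using e(2) power_minus_mult[of e \<pi>] by (simp add: power_add power2_eq_square mult_ac)
    also have "\<dots> \<le> (\<pi> * real n ^ 2) * (1 / 2)" using half \<pi>01 by (intro mult_left_mono) auto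
    finally have "\<pi> * real n ^ 2 / 2 \<le> card G" using G(3) by (simp add: card_cartesian_product power2_eq_square)
    moreover have "\<pi> * real n ^ 2 / 2 = real n powr (2 - a) / 4"
      using n0 by (simp add: \<pi>_def powr_diff powr_minus field_simps)
    ultimately show ?thesis by simp
  qed
  ultimately show ?thesis using G(1) by blast
qed

section \<open>Forbidding the rows of prescribed sizes\<close>

definition levels :: "nat \<Rightarrow> nat set \<Rightarrow> nat set set" where
  "levels d K = {t. t \<subseteq> {..d} \<and> card t \<in> K}"

lemma levels_subset: "levels d K \<subseteq> Pow {..d}"
  by (auto simp: levels_def)

lemma card_levels:
  assumes "finite K"
  shows "card (levels d K) = (\<Sum>k\<in>K. Suc d choose k)"
    and "(\<Sum>t\<in>levels d K. card t) = (\<Sum>k\<in>K. k * (Suc d choose k))"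
proof -
  let ?L = "\<lambda>k. {t. t \<subseteq> {..d} \<and> card t = k}"
  have L: "levels d K = (\<Union>k\<in>K. ?L k)" by (auto simp: levels_def)
  have fin: "\<forall>k\<in>K. finite (?L k)" by auto
  have disj: "\<forall>k\<in>K. \<forall>l\<in>K. k \<noteq> l \<longrightarrow> ?L k \<inter> ?L l = {}" by auto
  have card: "card (?L k) = Suc d choose k" for k using n_subsets[of "{..d}" k] by simp
  show "card (levels d K) = (\<Sum>k\<in>K. Suc d choose k)"
    unfolding L card_UN_disjoint[OF assms fin disj] card ..
  have sum: "(\<Sum>t\<in>?L k. card t) = k * (Suc d choose k)" for k
  proof -
    have "(\<Sum>t\<in>?L k. card t) = (\<Sum>t\<in>?L k. k)" by (rule sum.cong) auto
    then show ?thesis by (simp only: sum_constant card mult.commute[of k] of_nat_id)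
  qed
  show "(\<Sum>t\<in>levels d K. card t) = (\<Sum>k\<in>K. k * (Suc d choose k))"
    unfolding L sum.UNION_disjoint[OF assms fin disj] by (intro sum.cong refl sum)
qed

lemma exists_large_level_free:
  assumes "finite K" "0 \<notin> K" "n \<ge> 1" "K \<inter> {1..Suc d} \<noteq> {}"
    and e: "e = (\<Sum>k\<in>K. k * (Suc d choose k))" "e \<ge> 2"
    and a: "a = (real d + real (\<Sum>k\<in>K. Suc d choose k) - 1) / (real e - 1)"
  shows "\<exists>T G. T \<subseteq> Pow {..d} \<and> {} \<notin> T \<and> G \<subseteq> {..<n} \<times> {..<n} \<and> \<not> has_pattern T d n G \<and>
    real n powr (2 - a) / 4 \<le> card G"
proof -
  have ne: "levels d K \<noteq> {}"
  proof -
    obtain k where "k \<in> K" "k \<le> Suc d" using assms(4) by auto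
    moreover obtain t where "t \<subseteq> {..d}" "card t = k"
      using obtain_subset_with_card_n[of k "{..d}"] \<open>k \<le> Suc d\<close> by auto
    ultimately show ?thesis by (auto simp: levels_def)
  qed
  have "e = (\<Sum>t\<in>levels d K. card t)" using card_levels[OF assms(1)] e by simp
  moreover have "a = (real (d + card (levels d K)) - 1) / (real e - 1)"
    using card_levels[OF assms(1)] a by simp
  ultimately obtain G where G: "G \<subseteq> {..<n} \<times> {..<n}" "\<not> has_pattern (levels d K) d n G"
    "real n powr (2 - a) / 4 \<le> card G"
    using exists_large_pattern_free[OF levels_subset _ e(2) assms(3) ne] by metis
  have "{} \<notin> levels d K" using assms(2) by (auto simp: levels_def)
  with G show ?thesis by (intro exI[of _ "levels d K"] exI[of _ G] conjI levels_subset)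
qed

text \<open>Sizes 3 and 4 on four columns give 4 + 1 rows and 12 + 4 edges, so a = (3 + 5 - 1) / (16
  - 1). Adding the six pairs would raise this to 13/27.\<close>

lemma exists_large_pattern_free_3:
  assumes "n \<ge> 1"
  shows "\<exists>T G. T \<subseteq> Pow {..3} \<and> {} \<notin> T \<and> G \<subseteq> {..<n} \<times> {..<n} \<and> \<not> has_pattern T 3 n G \<and>
    real n powr (2 - 7 / 15) / 4 \<le> card G"
  by (rule exists_large_level_free[of "{3, 4}" n 3 16]) (use assms in \<open>simp_all add: numeral_eq_Suc\<close>)

text \<open>With b = d (d + 1) / 2 rows of size d - 1, v - 2 = b + 2 d + 1 and e - 1 = (d - 1) b + d
  (d + 1) + d; doubling both gives the fraction. For d = 2, 3, 4 it is 8/11, 13/27, 19/54, worse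
  than 1/2, 7/15, 1/3, hence the separate treatment of these cases.\<close>

lemma exists_large_pattern_free_ge:
  assumes "n \<ge> 1" "d \<ge> 2"
  shows "\<exists>T G. T \<subseteq> Pow {..d} \<and> {} \<notin> T \<and> G \<subseteq> {..<n} \<times> {..<n} \<and> \<not> has_pattern T d n G \<and>
    real n powr (2 - (real d ^ 2 + 5 * real d + 2) / (real d ^ 3 + 2 * real d ^ 2 + 3 * real d)) / 4 \<le> card G"
proof -
  define K where "K = {d - 1, d, d + 1}"
  define b where "b = Suc d choose (d - 1)"
  have "b = Suc d choose 2"
    unfolding b_def using binomial_symmetric[of 2 "Suc d"] assms(2) by (simp add: numeral_2_eq_2)
  moreover have "2 * (Suc d choose 2) = Suc d * d" by (simp add: choose_two)
  ultimately have "2 * real b = real (Suc d) * real d"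
    by (metis of_nat_mult of_nat_numeral)
  then have b: "real b = real d * (real d + 1) / 2"
    by (simp add: algebra_simps)
  have K: "(\<Sum>k\<in>K. f k) = f (d - 1) + f d + f (d + 1)" for f :: "nat \<Rightarrow> nat"
  proof -
    have "d - 1 \<noteq> d" "d - 1 \<noteq> d + 1" using assms(2) by auto
    then show ?thesis by (simp add: K_def)
  qed
  have cardK: "(\<Sum>k\<in>K. Suc d choose k) = b + d + 2"
    unfolding K b_def[symmetric] by simp
  define e where "e = (\<Sum>k\<in>K. k * (Suc d choose k))"
  have e: "e = (d - 1) * b + d * (d + 1) + (d + 1)"
    unfolding e_def K b_def[symmetric] by simp
  have ereal: "real e - 1 = (real d ^ 3 + 2 * real d ^ 2 + 3 * real d) / 2"
    unfolding e using assms(2) by (simp add: b of_nat_diff power2_eq_square power3_eq_cube field_simps)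
  have num: "real d + real (\<Sum>k\<in>K. Suc d choose k) - 1 = (real d ^ 2 + 5 * real d + 2) / 2"
    unfolding cardK by (simp add: b power2_eq_square field_simps)
  show ?thesis
  proof (rule exists_large_level_free[of K n d e])
    show "e = (\<Sum>k\<in>K. k * (Suc d choose k))" by (fact e_def)
    show "2 \<le> e" unfolding e using assms(2) by (simp add: add_increasing)
    show "(real d ^ 2 + 5 * real d + 2) / (real d ^ 3 + 2 * real d ^ 2 + 3 * real d)
        = (real d + real (\<Sum>k\<in>K. Suc d choose k) - 1) / (real e - 1)"
    proof -
      have "x / y = (x / 2) / (y / 2)" for x y :: real by simp
      then show ?thesis unfolding num ereal .
    qed
  qed (use assms in \<open>auto simp: K_def\<close>)
qed

section \<open>Pattern-free graphs from finite fields\<close>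

text \<open>In an algebraically closed field of characteristic 3 this is the subfield with \<open>3 ^ k\<close> elements.
  All these fields live in one type, and their orders are dense enough up to constant factors.\<close>

definition frob_fixed :: "nat \<Rightarrow> 'a::field set" where
  "frob_fixed k = {x. x ^ (3 ^ k) = x}"

lemma frob_fixed_mult: "x \<in> frob_fixed k \<Longrightarrow> y \<in> frob_fixed k \<Longrightarrow> x * y \<in> frob_fixed k"
  by (simp add: frob_fixed_def power_mult_distrib)

lemma frob_fixed_divide: "x \<in> frob_fixed k \<Longrightarrow> y \<in> frob_fixed k \<Longrightarrow> x / y \<in> frob_fixed k"
  by (simp add: frob_fixed_def power_divide)

lemma frob_fixed_0: "0 \<in> frob_fixed k" and frob_fixed_1: "1 \<in> frob_fixed k"
  by (simp_all add: frob_fixed_def)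

lemma frob_add:
  fixes x y :: "'a::field"
  assumes "(3::'a) = 0"
  shows "(x + y) ^ (3 ^ k) = x ^ (3 ^ k) + y ^ (3 ^ k)"
proof (induction k)
  case (Suc k)
  have cube: "(a + b) ^ 3 = a ^ 3 + b ^ 3" for a b :: 'a
  proof -
    have "(a + b) ^ 3 = a ^ 3 + b ^ 3 + 3 * (a\<^sup>2 * b + a * b\<^sup>2)"
      by (simp add: power2_eq_square power3_eq_cube algebra_simps)
    then show ?thesis using assms by simp
  qed
  have "z ^ (3 ^ Suc k) = (z ^ (3 ^ k)) ^ 3" for z :: 'a
    by (metis power_Suc2 power_mult)
  then show ?case by (simp only: Suc.IH cube)
qed simp

lemma frob_fixed_add:
  "(3::'a::field) = 0 \<Longrightarrow> x \<in> frob_fixed k \<Longrightarrow> y \<in> frob_fixed k \<Longrightarrow> x + y \<in> (frob_fixed k :: 'a set)"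
  by (simp add: frob_fixed_def frob_add)

lemma frob_fixed_minus: "x \<in> frob_fixed k \<Longrightarrow> - x \<in> frob_fixed k"
  by (simp add: frob_fixed_def)

lemma frob_fixed_diff:
  "(3::'a::field) = 0 \<Longrightarrow> x \<in> frob_fixed k \<Longrightarrow> y \<in> frob_fixed k \<Longrightarrow> x - y \<in> (frob_fixed k :: 'a set)"
  using frob_fixed_add[of x k "-y"] frob_fixed_minus[of y k] by simp

text \<open>The elements are the roots of X^q - X with q = 3^k. Its derivative is -1, so it splits
  into q distinct linear factors.\<close>

lemma frob_fixed_card:
  assumes three: "(3::'a::alg_closed_field) = 0" and "k \<ge> 1"
  shows "finite (frob_fixed k :: 'a set)" "card (frob_fixed k :: 'a set) = 3 ^ k"
proof -
  define q :: nat where "q = 3 ^ k"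
  have q: "q > 1" using \<open>k \<ge> 1\<close> one_less_power[of "3::nat" k] by (simp add: q_def)
  have q0: "(of_nat q :: 'a) = 0" using three \<open>k \<ge> 1\<close> by (simp add: q_def)
  define P :: "'a poly" where "P = Polynomial.monom 1 q - Polynomial.monom 1 1"
  have deg: "Polynomial.degree P = q"
    unfolding P_def using q degree_add_eq_left[of "- Polynomial.monom 1 1" "Polynomial.monom (1::'a) q"]
    by (simp add: degree_monom_eq)
  then have "P \<noteq> 0" using q by auto
  then obtain A where A: "size A = q" "P = smult (Polynomial.lead_coeff P) (\<Prod>x\<in>#A. [:-x, 1:])"
    using alg_closed_imp_factorization[of P] deg by auto
  have P': "pderiv P = -1"
    using q0 by (simp add: P_def pderiv_diff pderiv_monom one_pCons monom_0)
  have count: "count A x = 1" if x: "x \<in># A" for x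
  proof (rule ccontr)
    assume "count A x \<noteq> 1"
    obtain B where B: "A = add_mset x B" using x by (meson multi_member_split)
    with \<open>count A x \<noteq> 1\<close> have "x \<in># B" by (auto simp: not_in_iff)
    then obtain C where C: "B = add_mset x C" by (meson multi_member_split)
    define r where "r = smult (Polynomial.lead_coeff P) (\<Prod>x\<in>#C. [:-x, 1:])"
    have "P = [:-x, 1:] * ([:-x, 1:] * r)"
      using A(2) unfolding B C r_def by (simp add: mult_smult_right)
    then have "pderiv P = [:-x, 1:] * pderiv ([:-x, 1:] * r) + [:-x, 1:] * r * pderiv [:-x, 1:]"
      by (simp only: pderiv_mult)
    then have "poly (pderiv P) x = 0" by (simp only: poly_add poly_mult) simp
    then show False unfolding P' by simp
  qed
  have "x \<in> frob_fixed k \<longleftrightarrow> x \<in># A" for x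
  proof -
    have "x \<in> frob_fixed k \<longleftrightarrow> poly P x = 0" by (simp add: frob_fixed_def P_def poly_monom q_def)
    also have "\<dots> \<longleftrightarrow> poly (\<Prod>x\<in>#A. [:-x, 1:]) x = 0"
      using \<open>P \<noteq> 0\<close> by (subst A(2)) simp
    also have "\<dots> \<longleftrightarrow> x \<in># A" by (auto simp: poly_prod_mset image_iff)
    finally show ?thesis .
  qed
  then have F: "frob_fixed k = set_mset A" by auto
  show "finite (frob_fixed k :: 'a set)" unfolding F by simp
  have "size A = (\<Sum>x\<in>set_mset A. 1)"
    unfolding size_multiset_overloaded_eq by (intro sum.cong) (auto simp: count)
  then show "card (frob_fixed k :: 'a set) = 3 ^ k" using A(1) by (simp add: F q_def)
qed

text \<open>If squaring were onto this finite set it would be injective, but 1 and -1 have the same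
  square and differ in characteristic 3.\<close>

lemma frob_fixed_nonsquare:
  assumes three: "(3::'a::alg_closed_field) = 0" and "k \<ge> 1"
  shows "\<exists>g\<in>frob_fixed k. \<forall>s\<in>frob_fixed k. s\<^sup>2 \<noteq> (g::'a)"
proof (rule ccontr)
  assume "\<not> ?thesis"
  then have "frob_fixed k \<subseteq> (\<lambda>s. s\<^sup>2) ` (frob_fixed k :: 'a set)" by auto
  then have "inj_on (\<lambda>s. s\<^sup>2) (frob_fixed k :: 'a set)"
    using frob_fixed_card(1)[OF assms] frob_fixed_mult
    by (intro finite_surj_inj) (auto simp: power2_eq_square)
  then have "(1::'a) = -1"
    by (rule inj_onD) (simp_all add: frob_fixed_1 frob_fixed_minus)
  then have "(2::'a) = 0" by (metis add.right_inverse one_add_one)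
  moreover have "(3::'a) = 2 + 1" by simp
  ultimately show False using three by simp
qed

section \<open>Geometry of the form \<open>x1\<^sup>2 - x2 * x3\<close>\<close>

lemma proportional_if_cross_zero:
  fixes u1 :: "'a::field"
  assumes "(u1, u2, u3) \<noteq> (0, 0, 0)"
    and "u2 * v3 = u3 * v2" "u3 * v1 = u1 * v3" "u1 * v2 = u2 * v1"
  shows "\<exists>c. v1 = c * u1 \<and> v2 = c * u2 \<and> v3 = c * u3"
proof -
  consider "u1 \<noteq> 0" | "u2 \<noteq> 0" | "u3 \<noteq> 0" using assms(1) by auto
  then show ?thesis
  proof cases
    case 1
    then show ?thesis using assms by (intro exI[of _ "v1 / u1"]) (auto simp: field_simps)
  next
    case 2
    then show ?thesis using assms by (intro exI[of _ "v2 / u2"]) (auto simp: field_simps)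
  next
    case 3
    then show ?thesis using assms by (intro exI[of _ "v3 / u3"]) (auto simp: field_simps)
  qed
qed

text \<open>Two orthogonal subspaces of a nondegenerate three-dimensional space cannot both be planes.\<close>

lemma proportional_if_orthogonal:
  fixes u1 :: "'a::field"
  assumes two: "(2::'a) \<noteq> 0" and "(u1, u2, u3) \<noteq> (0, 0, 0)" "(p1, p2, p3) \<noteq> (0, 0, 0)"
    and pu: "2 * p1 * u1 - p2 * u3 - p3 * u2 = 0" and pv: "2 * p1 * v1 - p2 * v3 - p3 * v2 = 0"
    and ru: "2 * r1 * u1 - r2 * u3 - r3 * u2 = 0" and rv: "2 * r1 * v1 - r2 * v3 - r3 * v2 = 0"
  shows "(\<exists>c. v1 = c * u1 \<and> v2 = c * u2 \<and> v3 = c * u3) \<or> (\<exists>c. r1 = c * p1 \<and> r2 = c * p2 \<and> r3 = c * p3)"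
proof -
  \<comment> \<open>The cross product of \<open>u\<close> and \<open>v\<close>. The hypotheses are
    dot products with the dual vectors (2 p1, -p3, -p2) and (2 r1, -r3, -r2); orthogonal to both
    \<open>u\<close> and \<open>v\<close>, these are multiples of \<open>w\<close> when
    \<open>w\<close> is nonzero.\<close>
  define w1 where "w1 = u2 * v3 - u3 * v2"
  define w2 where "w2 = u3 * v1 - u1 * v3"
  define w3 where "w3 = u1 * v2 - u2 * v1"
  show ?thesis
  proof (cases "(w1, w2, w3) = (0, 0, 0)")
    case True
    then show ?thesis using proportional_if_cross_zero[OF assms(2), of v3 v2 v1]
      by (auto simp: w1_def w2_def w3_def)
  next
    case False
    have cross: "w2 * (- s2) = w3 * (- s3) \<and> w3 * s1 = w1 * (- s2) \<and> w1 * (- s3) = w2 * s1"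
      if s: "s1 * u1 - s2 * u3 - s3 * u2 = 0" "s1 * v1 - s2 * v3 - s3 * v2 = 0" for s1 s2 s3
    proof -
      have "w2 * (- s2) - w3 * (- s3)
          = u1 * - (s1 * v1 - s2 * v3 - s3 * v2) + v1 * (s1 * u1 - s2 * u3 - s3 * u2)"
        "w3 * s1 - w1 * (- s2)
          = v2 * (s1 * u1 - s2 * u3 - s3 * u2) - u2 * (s1 * v1 - s2 * v3 - s3 * v2)"
        "w1 * (- s3) - w2 * s1
          = v3 * (s1 * u1 - s2 * u3 - s3 * u2) - u3 * (s1 * v1 - s2 * v3 - s3 * v2)"
        unfolding w1_def w2_def w3_def by (simp_all add: algebra_simps)
      then show ?thesis unfolding s
        by (simp only: right_minus_eq minus_zero mult_zero_right add_0 diff_zero simp_thms)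
    qed
    obtain c where c: "2 * p1 = c * w1" "- p3 = c * w2" "- p2 = c * w3"
      using proportional_if_cross_zero[OF False, of "- p2" "- p3" "2 * p1"] cross[OF pu pv] by blast
    obtain d where d: "2 * r1 = d * w1" "- r3 = d * w2" "- r2 = d * w3"
      using proportional_if_cross_zero[OF False, of "- r2" "- r3" "2 * r1"] cross[OF ru rv] by blast
    have "c \<noteq> 0" using c assms(3) two by auto
    then have "2 * r1 = d / c * (2 * p1)" "- r3 = d / c * (- p3)" "- r2 = d / c * (- p2)"
      unfolding c d by auto
    then have "2 * r1 = 2 * (d / c * p1)" "r3 = d / c * p3" "r2 = d / c * p2"
      by (auto simp: algebra_simps)
    moreover from this have "r1 = d / c * p1" using two by (metis mult_left_cancel)
    ultimately show ?thesis by blast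
  qed
qed

text \<open>The surface \<open>x\<^sup>2 - y z = g\<close> contains no line when \<open>g\<close> is not a square.\<close>

lemma square_if_isotropic_orthogonal:
  assumes three: "(3::'a::field) = 0"
    and F: "u1 \<in> frob_fixed k" "u2 \<in> frob_fixed k" "w1 \<in> frob_fixed k" "w2 \<in> frob_fixed k"
    and "(u1, u2, u3) \<noteq> (0, 0, 0)" "u1\<^sup>2 - u2 * u3 = 0" "2 * w1 * u1 - w2 * u3 - w3 * u2 = 0"
  shows "\<exists>s\<in>frob_fixed k. s\<^sup>2 = w1\<^sup>2 - w2 * (w3 :: 'a)"
proof (cases "u2 = 0")
  case True
  then have "u1 = 0" using assms(7) by simp
  with True assms(6,8) have "w2 = 0" by auto
  then show ?thesis using F by auto
next
  case False
  \<comment> \<open>The isotropic vector is \<open>u2\<close> times (t, 1, t^2). Orthogonality then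
    determines \<open>w3\<close> and turns the form at \<open>w\<close> into the square of
    \<open>w1 - w2 * t\<close>.\<close>
  define t where "t = u1 / u2"
  have u: "u1 = t * u2" "u3 = t\<^sup>2 * u2" using False assms(7)
    by (auto simp: t_def field_simps power2_eq_square)
  have "u2 * (2 * w1 * t - w2 * t\<^sup>2 - w3) = 0" using assms(8) unfolding u by (simp add: algebra_simps)
  then have "w3 = 2 * w1 * t - w2 * t\<^sup>2" using False by simp
  then have "(w1 - w2 * t)\<^sup>2 = w1\<^sup>2 - w2 * w3"
    by (simp only:) (simp add: power2_eq_square algebra_simps)
  moreover have "w1 - w2 * t \<in> frob_fixed k"
    unfolding t_def using F by (intro frob_fixed_diff[OF three] frob_fixed_mult frob_fixed_divide)
  ultimately show ?thesis by blast
qed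

definition quadric_rel :: "'a::field \<Rightarrow> 'a \<times> 'a \<times> 'a \<Rightarrow> 'a \<times> 'a \<times> 'a \<Rightarrow> bool" where
  "quadric_rel g = (\<lambda>(a1, a2, a3) (x1, x2, x3). (x1 - a1)\<^sup>2 - (x2 - a2) * (x3 - a3) = g)"

lemma quadric_rel_sym: "quadric_rel g v w = quadric_rel g w v"
  by (cases v; cases w) (simp add: quadric_rel_def power2_eq_square algebra_simps)

text \<open>Along the line through the three points the equation is quadratic in the parameter, with
  the three distinct roots 0, 1 and \<open>l\<close>. So \<open>u\<close> is isotropic and
  orthogonal to \<open>w\<close>, and then \<open>g\<close> would be a square.\<close>

lemma quadric_rel_collinear_False:
  assumes three: "(3::'a::field) = 0" and g: "\<forall>s\<in>frob_fixed k. s\<^sup>2 \<noteq> (g :: 'a)"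
    and F: "{a1, a2, b1, b2, x1, x2} \<subseteq> frob_fixed k"
    and ne: "(a1, a2, a3) \<noteq> (b1, b2, b3)" "(a1, a2, a3) \<noteq> (c1, c2, c3)" "(b1, b2, b3) \<noteq> (c1, c2, c3)"
    and rel: "quadric_rel g (a1, a2, a3) (x1, x2, x3)" "quadric_rel g (b1, b2, b3) (x1, x2, x3)"
      "quadric_rel g (c1, c2, c3) (x1, x2, x3)"
    and col: "c1 - a1 = l * (b1 - a1)" "c2 - a2 = l * (b2 - a2)" "c3 - a3 = l * (b3 - a3)"
  shows False
proof -
  define u1 u2 u3 where u: "u1 = b1 - a1" "u2 = b2 - a2" "u3 = b3 - a3"
  define w1 w2 w3 where w: "w1 = x1 - a1" "w2 = x2 - a2" "w3 = x3 - a3"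
  have l: "l \<noteq> 0" "l \<noteq> 1" using ne(2,3) col by auto
  have W: "w1\<^sup>2 - w2 * w3 = g" using rel(1) by (simp add: quadric_rel_def w)
  have expand: "v1\<^sup>2 - v2 * v3 = 2 * w1 * v1 - w2 * v3 - w3 * v2"
    if "(w1 - v1)\<^sup>2 - (w2 - v2) * (w3 - v3) = g" for v1 v2 v3
  proof -
    have "(w1 - v1)\<^sup>2 - (w2 - v2) * (w3 - v3)
        = (w1\<^sup>2 - w2 * w3) + ((v1\<^sup>2 - v2 * v3) - (2 * w1 * v1 - w2 * v3 - w3 * v2))"
      by (simp add: power2_eq_square algebra_simps)
    then show ?thesis unfolding that W by simp
  qed
  have "(w1 - u1)\<^sup>2 - (w2 - u2) * (w3 - u3) = g"
    using rel(2) by (simp add: quadric_rel_def w u)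
  then have Qu: "u1\<^sup>2 - u2 * u3 = 2 * w1 * u1 - w2 * u3 - w3 * u2" by (rule expand)
  have c: "c1 = a1 + l * u1" "c2 = a2 + l * u2" "c3 = a3 + l * u3"
    using col by (auto simp: u algebra_simps)
  have "(w1 - l * u1)\<^sup>2 - (w2 - l * u2) * (w3 - l * u3) = g"
    using rel(3) unfolding c by (simp add: quadric_rel_def w diff_diff_eq)
  then have "(l * u1)\<^sup>2 - (l * u2) * (l * u3) = 2 * w1 * (l * u1) - w2 * (l * u3) - w3 * (l * u2)"
    by (rule expand)
  moreover have "\<dots> = l * (u1\<^sup>2 - u2 * u3)" unfolding Qu by (simp add: algebra_simps)
  moreover have "(l * u1)\<^sup>2 - (l * u2) * (l * u3) = l * (l * (u1\<^sup>2 - u2 * u3))"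
    by (simp add: power2_eq_square algebra_simps)
  ultimately have "l * (l * (u1\<^sup>2 - u2 * u3)) = l * (u1\<^sup>2 - u2 * u3)" by simp
  then have "l * ((l - 1) * (u1\<^sup>2 - u2 * u3)) = 0" by (simp add: left_diff_distrib)
  then have "u1\<^sup>2 - u2 * u3 = 0" using l by simp
  moreover have "(u1, u2, u3) \<noteq> (0, 0, 0)" using ne(1) by (auto simp: u)
  ultimately have "\<exists>s\<in>frob_fixed k. s\<^sup>2 = w1\<^sup>2 - w2 * w3"
    using Qu F by (intro square_if_isotropic_orthogonal[OF three])
      (auto simp: u w intro!: frob_fixed_diff[OF three])
  with W g show False by blast
qed

text \<open>In the alternating sum of the four equations for two centres and two points the
  quadratic terms cancel: differences within \<open>A\<close>, \<open>B\<close>, \<open>C\<close>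
  are orthogonal to differences within \<open>P\<close>, \<open>Q\<close>, \<open>R\<close>. One of
  the triples is therefore collinear, and the relation is symmetric.\<close>

lemma quadric_rel_K33_free:
  assumes three: "(3::'a::field) = 0" and g: "\<forall>s\<in>frob_fixed k. s\<^sup>2 \<noteq> (g :: 'a)"
    and V: "{A, B, C, P, Q, R} \<subseteq> frob_fixed k \<times> frob_fixed k \<times> frob_fixed k"
    and ne: "A \<noteq> B" "A \<noteq> C" "B \<noteq> C" "P \<noteq> Q" "P \<noteq> R" "Q \<noteq> R"
    and rel: "\<And>v w. v \<in> {A, B, C} \<Longrightarrow> w \<in> {P, Q, R} \<Longrightarrow> quadric_rel g v w"
  shows False
proof -
  obtain a1 a2 a3 b1 b2 b3 c1 c2 c3 where ABC: "A = (a1, a2, a3)" "B = (b1, b2, b3)" "C = (c1, c2, c3)"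
    by (metis prod_cases3)
  obtain x1 x2 x3 y1 y2 y3 z1 z2 z3 where PQR: "P = (x1, x2, x3)" "Q = (y1, y2, y3)" "R = (z1, z2, z3)"
    by (metis prod_cases3)
  have two: "(2::'a) \<noteq> 0"
  proof
    assume "(2::'a) = 0"
    moreover have "(3::'a) = 2 + 1" by simp
    ultimately show False using three by simp
  qed
  have orth: "2 * (s1 - x1) * (t1 - a1) - (s2 - x2) * (t3 - a3) - (s3 - x3) * (t2 - a2) = 0"
    if rel: "quadric_rel g (a1, a2, a3) (x1, x2, x3)" "quadric_rel g (a1, a2, a3) (s1, s2, s3)"
      "quadric_rel g (t1, t2, t3) (x1, x2, x3)" "quadric_rel g (t1, t2, t3) (s1, s2, s3)"
    for s1 s2 s3 t1 t2 t3
  proof -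
    have "2 * (s1 - x1) * (t1 - a1) - (s2 - x2) * (t3 - a3) - (s3 - x3) * (t2 - a2)
      = ((s1 - a1)\<^sup>2 - (s2 - a2) * (s3 - a3)) - ((s1 - t1)\<^sup>2 - (s2 - t2) * (s3 - t3))
        - ((x1 - a1)\<^sup>2 - (x2 - a2) * (x3 - a3)) + ((x1 - t1)\<^sup>2 - (x2 - t2) * (x3 - t3))"
      by (simp add: power2_eq_square algebra_simps)
    also have "\<dots> = g - g - g + g" using rel unfolding quadric_rel_def prod.case by (simp only:)
    finally show ?thesis by simp
  qed
  have "(\<exists>l. c1 - a1 = l * (b1 - a1) \<and> c2 - a2 = l * (b2 - a2) \<and> c3 - a3 = l * (b3 - a3)) \<or>
      (\<exists>l. z1 - x1 = l * (y1 - x1) \<and> z2 - x2 = l * (y2 - x2) \<and> z3 - x3 = l * (y3 - x3))"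
    by (rule proportional_if_orthogonal[OF two]; (rule orth)?)
       (use rel ne in \<open>auto simp: ABC PQR\<close>)
  then show False
  proof
    assume "\<exists>l. c1 - a1 = l * (b1 - a1) \<and> c2 - a2 = l * (b2 - a2) \<and> c3 - a3 = l * (b3 - a3)"
    then obtain l where l: "c1 - a1 = l * (b1 - a1)" "c2 - a2 = l * (b2 - a2)" "c3 - a3 = l * (b3 - a3)"
      by blast
    show False
      by (rule quadric_rel_collinear_False[OF three g _ _ _ _ _ _ _ l, of x1 x2 x3])
         (use V ne rel in \<open>auto simp: ABC PQR\<close>)
  next
    assume "\<exists>l. z1 - x1 = l * (y1 - x1) \<and> z2 - x2 = l * (y2 - x2) \<and> z3 - x3 = l * (y3 - x3)"
    then obtain l where l: "z1 - x1 = l * (y1 - x1)" "z2 - x2 = l * (y2 - x2)" "z3 - x3 = l * (y3 - x3)"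
      by blast
    show False
      by (rule quadric_rel_collinear_False[OF three g _ _ _ _ _ _ _ l, of a1 a2 a3])
         (use V ne rel in \<open>auto simp: ABC PQR quadric_rel_sym\<close>)
  qed
qed

text \<open>\<open>\<beta>\<close> decodes indices to elements of \<open>V\<close>; surplus indices
  stay isolated. Injectivity is stated only at endpoints of edges, which suffices because the rows
  and columns to be told apart in a pattern are such endpoints.\<close>

lemma relation_graph:
  assumes "finite V" "card V \<le> n"
  obtains G \<beta> where "G \<subseteq> {..<n} \<times> {..<n}" "card G = (\<Sum>v\<in>V. card {w\<in>V. R v w})"
    "\<And>i j. (i, j) \<in> G \<Longrightarrow> \<beta> i \<in> V \<and> \<beta> j \<in> V \<and> R (\<beta> i) (\<beta> j)"
    "\<And>i j i' j'. (i, j) \<in> G \<Longrightarrow> (i', j') \<in> G \<Longrightarrow> (\<beta> i = \<beta> i' \<longleftrightarrow> i = i') \<and> (\<beta> j = \<beta> j' \<longleftrightarrow> j = j')"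
proof -
  obtain \<gamma> where \<gamma>: "bij_betw \<gamma> V {0..<card V}" using ex_bij_betw_finite_nat[OF assms(1)] by blast
  define E where "E = (SIGMA v:V. {w\<in>V. R v w})"
  define G where "G = (\<lambda>(v, w). (\<gamma> v, \<gamma> w)) ` E"
  have inj: "inj_on \<gamma> V" using \<gamma> by (simp add: bij_betw_def)
  have range: "\<gamma> v < n" if "v \<in> V" for v
    using bij_betwE[OF \<gamma>] that assms(2) by fastforce
  have inv: "inv_into V \<gamma> (\<gamma> v) = v" if "v \<in> V" for v using inv_into_f_f[OF inj that] .
  show thesis
  proof (rule that[of G "inv_into V \<gamma>"])
    show "G \<subseteq> {..<n} \<times> {..<n}" using range by (auto simp: G_def E_def)
    have "inj_on (\<lambda>(v, w). (\<gamma> v, \<gamma> w)) E"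
      using inj by (auto simp: E_def inj_on_def)
    then show "card G = (\<Sum>v\<in>V. card {w\<in>V. R v w})"
      using assms(1) by (simp add: G_def E_def card_image)
  qed (auto simp: G_def E_def inv)
qed

text \<open>Here \<open>v\<close> is a line given by slope and intercept, \<open>w\<close> a point
  on it. Each of the q^2 non-vertical lines has q points, where q = 3^k.\<close>

lemma line_rel_card:
  assumes three: "(3::'a::alg_closed_field) = 0" and "k \<ge> 1"
  defines "V \<equiv> (frob_fixed k \<times> frob_fixed k :: ('a \<times> 'a) set)"
  shows "(\<Sum>v\<in>V. card {w\<in>V. snd w = fst v * fst w + snd v}) = (3 ^ k) ^ 3"
proof -
  let ?F = "frob_fixed k :: 'a set"
  have "card {w\<in>V. snd w = fst v * fst w + snd v} = 3 ^ k" if "v \<in> V" for v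
  proof -
    have "{w\<in>V. snd w = fst v * fst w + snd v} = (\<lambda>x. (x, fst v * x + snd v)) ` ?F"
      using that by (auto simp: V_def intro!: frob_fixed_add[OF three] frob_fixed_mult)
    moreover have "inj_on (\<lambda>x. (x, fst v * x + snd v)) ?F" by (auto simp: inj_on_def)
    ultimately show ?thesis using frob_fixed_card(2)[OF three \<open>k \<ge> 1\<close>] by (simp add: card_image)
  qed
  then have "(\<Sum>v\<in>V. card {w\<in>V. snd w = fst v * fst w + snd v}) = card V * 3 ^ k" by simp
  also have "card V = 3 ^ k * 3 ^ k"
    unfolding V_def card_cartesian_product frob_fixed_card(2)[OF three \<open>k \<ge> 1\<close>] ..
  finally show ?thesis by (simp add: power3_eq_cube)
qed

lemma quadric_rel_card:
  assumes three: "(3::'a::alg_closed_field) = 0" and "k \<ge> 1"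
    and g: "g \<in> frob_fixed k"
  defines "V \<equiv> (frob_fixed k \<times> frob_fixed k \<times> frob_fixed k :: ('a \<times> 'a \<times> 'a) set)"
  shows "(3 ^ k) ^ 4 * (3 ^ k - 1) \<le> (\<Sum>v\<in>V. card {w\<in>V. quadric_rel g v w})"
proof -
  let ?F = "frob_fixed k :: 'a set"
  note cF = frob_fixed_card[OF three \<open>k \<ge> 1\<close>]
  have deg: "3 ^ k * (3 ^ k - 1) \<le> card {w\<in>V. quadric_rel g v w}" if v: "v \<in> V" for v
  proof -
    obtain a b c where abc: "v = (a, b, c)" "a \<in> ?F" "b \<in> ?F" "c \<in> ?F" using v by (auto simp: V_def)
    \<comment> \<open>Off the plane where the second difference is 0, the equation determines the
      third difference from the other two, which yields q (q - 1) neighbours for q = 3^k.\<close>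
    define f where "f = (\<lambda>(x, y). (a + x, b + y, c + (x * x - g) / y))"
    have "inj_on f (?F \<times> (?F - {0}))" by (auto simp: inj_on_def f_def)
    then have "card (f ` (?F \<times> (?F - {0}))) = 3 ^ k * (3 ^ k - 1)"
      using cF by (simp add: card_image card_cartesian_product card_Diff_singleton frob_fixed_0)
    moreover have sub: "f ` (?F \<times> (?F - {0})) \<subseteq> {w\<in>V. quadric_rel g v w}"
      using abc g by (auto simp: f_def V_def quadric_rel_def power2_eq_square
        intro!: frob_fixed_add[OF three] frob_fixed_diff[OF three] frob_fixed_mult frob_fixed_divide)
    moreover have "finite V" unfolding V_def using cF(1) by (intro finite_cartesian_product)
    ultimately show ?thesis using card_mono[OF _ sub] by simp
  qed
  have "card V = (3 ^ k) ^ 3"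
    unfolding V_def card_cartesian_product cF(2) by (simp add: power3_eq_cube)
  then have "(3 ^ k) ^ 4 * (3 ^ k - 1) = card V * (3 ^ k * (3 ^ k - 1))"
    by (simp add: numeral_eq_Suc)
  also have "\<dots> \<le> (\<Sum>v\<in>V. card {w\<in>V. quadric_rel g v w})"
    using sum_bounded_below[of V "3 ^ k * (3 ^ k - 1)" "\<lambda>v. card {w\<in>V. quadric_rel g v w}"] deg by simp
  finally show ?thesis .
qed

section \<open>Graphs free of the patterns for d = 2 and d = 4\<close>

lemma three_eq_0: "(3 :: Enum.finite_3 alg_closure) = 0"
proof -
  have "(3 :: Enum.finite_3) = 1 + 1 + 1" by (simp only: numeral_Bit1 numeral_One)
  also have "\<dots> = 0"
    by (simp only: plus_finite_3_def one_finite_3_def zero_finite_3_def prod.case finite_3.case)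
  finally have "(3 :: Enum.finite_3) = 0" .
  then have "to_ac (3 :: Enum.finite_3) = 0" by (simp only: to_ac_0)
  then show ?thesis by (simp only: to_ac_numeral)
qed

lemma exists_large_pattern_free_2:
  assumes "n \<ge> 9"
  shows "\<exists>T G. T \<subseteq> Pow {..2} \<and> {} \<notin> T \<and> G \<subseteq> {..<n} \<times> {..<n} \<and> \<not> has_pattern T 2 n G \<and>
    real n powr (2 - 1 / 2) / 27 \<le> card G"
proof -
  obtain k where k: "9 ^ k \<le> n" "n < 9 ^ (k + 1)" using ex_power_ivl1[of 9 n] assms by auto
  have "k \<ge> 1" using k assms by (cases k) auto
  define q :: nat where "q = 3 ^ k"
  have q2: "q\<^sup>2 = 9 ^ k" by (simp add: q_def power2_eq_square flip: power_mult_distrib)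
  define V where "V = (frob_fixed k \<times> frob_fixed k :: (Enum.finite_3 alg_closure \<times> Enum.finite_3 alg_closure) set)"
  note cF = frob_fixed_card[OF three_eq_0 \<open>k \<ge> 1\<close>]
  have "finite V" "card V = q\<^sup>2" using cF by (auto simp: V_def card_cartesian_product q_def power2_eq_square)
  then have "card V \<le> n" using k q2 by simp
  obtain G \<beta> where G: "G \<subseteq> {..<n} \<times> {..<n}"
      "card G = (\<Sum>v\<in>V. card {w\<in>V. snd w = fst v * fst w + snd v})"
    and \<beta>: "\<And>i j. (i, j) \<in> G \<Longrightarrow> \<beta> i \<in> V \<and> \<beta> j \<in> V \<and> snd (\<beta> j) = fst (\<beta> i) * fst (\<beta> j) + snd (\<beta> i)"
    and inj: "\<And>i j i' j'. (i, j) \<in> G \<Longrightarrow> (i', j') \<in> G \<Longrightarrow> (\<beta> i = \<beta> i' \<longleftrightarrow> i = i') \<and> (\<beta> j = \<beta> j' \<longleftrightarrow> j = j')"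
    by (rule relation_graph[OF \<open>finite V\<close> \<open>card V \<le> n\<close>, of "\<lambda>v w. snd w = fst v * fst w + snd v"]) blast
  have cardG: "card G = q ^ 3"
    unfolding G(2) V_def q_def by (rule line_rel_card[OF three_eq_0 \<open>k \<ge> 1\<close>])
  \<comment> \<open>Both sets contain 0 and 1, so two rows share two columns: two distinct lines
    through two distinct points.\<close>
  define T :: "nat set set" where "T = {{0, 1}, {0, 1, 2}}"
  have "\<not> has_pattern T 2 n G"
  proof
    assume "has_pattern T 2 n G"
    then obtain \<rho> c where \<rho>: "inj_on \<rho> T" and c: "inj_on c {..2}"
      and e: "\<And>t j. t \<in> T \<Longrightarrow> j \<in> t \<Longrightarrow> (\<rho> t, c j) \<in> G" unfolding has_pattern_def by blast
    define i i' where ii: "i = \<rho> {0, 1}" "i' = \<rho> {0, 1, 2}"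
    have G4: "(i, c 0) \<in> G" "(i, c 1) \<in> G" "(i', c 0) \<in> G" "(i', c 1) \<in> G"
      unfolding ii by (rule e; simp add: T_def)+
    have "2 \<in> {0, 1, 2 :: nat}" "2 \<notin> {0, 1 :: nat}" by simp_all
    then have "{0, 1} \<noteq> {0, 1, 2 :: nat}" by metis
    moreover have "{0, 1} \<in> T" "{0, 1, 2} \<in> T" unfolding T_def by (rule insertI1, rule insertI2, rule insertI1)
    ultimately have "i \<noteq> i'" unfolding ii using inj_onD[OF \<rho>] by metis
    then have ne1: "\<beta> i \<noteq> \<beta> i'" using inj[OF G4(1,3)] by simp
    have "c 0 \<noteq> c 1" using inj_onD[OF c, of 0 1] by auto
    then have ne2: "\<beta> (c 0) \<noteq> \<beta> (c 1)" using inj[OF G4(1,2)] by simp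
    obtain a b a' b' x y x' y' where p: "\<beta> i = (a, b)" "\<beta> i' = (a', b')" "\<beta> (c 0) = (x, y)" "\<beta> (c 1) = (x', y')"
      by (metis surj_pair)
    have eq: "y = a * x + b" "y' = a * x' + b" "y = a' * x + b'" "y' = a' * x' + b'"
      using \<beta>[OF G4(1)] \<beta>[OF G4(2)] \<beta>[OF G4(3)] \<beta>[OF G4(4)] unfolding p by simp_all
    have "(a - a') * (x - x') = ((a * x + b) - (a' * x + b')) - ((a * x' + b) - (a' * x' + b'))"
      by (simp add: algebra_simps)
    also have "\<dots> = 0" using eq by (metis diff_self)
    finally have "a = a' \<or> x = x'" by simp
    then show False
    proof
      assume "a = a'"
      then have "b = b'" using eq(1,3) by simp
      with \<open>a = a'\<close> ne1 show False unfolding p by simp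
    next
      assume "x = x'"
      with eq(1,2) ne2 show False unfolding p by simp
    qed
  qed
  moreover have "real n powr (2 - 1 / 2) / 27 \<le> card G"
  proof -
    \<comment> \<open>Passing from \<open>9 ^ k\<close> to \<open>9 ^ (k + 1)\<close> costs a factor
      3 in \<open>q\<close>, whence 27 = 3^3.\<close>
    have "n \<le> (3 * q)\<^sup>2" using k q2 by (simp add: power_mult_distrib)
    then have "real n \<le> (3 * real q)\<^sup>2" by (metis of_nat_le_iff of_nat_mult of_nat_numeral of_nat_power)
    also have "\<dots> = (3 * real q) powr 2" by simp
    finally have "real n powr (3 / 2) \<le> ((3 * real q) powr 2) powr (3 / 2)" by (intro powr_mono2) auto
    also have "\<dots> = (3 * real q) powr 3" unfolding powr_powr by simp
    also have "\<dots> = (3 * real q) ^ 3" by simp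
    also have "\<dots> = 27 * card G" by (simp add: cardG power_mult_distrib)
    finally show ?thesis by simp
  qed
  ultimately show ?thesis using G(1)
    by (intro exI[of _ T] exI[of _ G] conjI) (auto simp: T_def)
qed

lemma exists_large_pattern_free_4:
  assumes "n \<ge> 27"
  shows "\<exists>T G. T \<subseteq> Pow {..4} \<and> {} \<notin> T \<and> G \<subseteq> {..<n} \<times> {..<n} \<and> \<not> has_pattern T 4 n G \<and>
    real n powr (2 - 1 / 3) / 486 \<le> card G"
proof -
  obtain k where k: "27 ^ k \<le> n" "n < 27 ^ (k + 1)" using ex_power_ivl1[of 27 n] assms by auto
  have "k \<ge> 1" using k assms by (cases k) auto
  define q :: nat where "q = 3 ^ k"
  have q3: "q ^ 3 = 27 ^ k" by (simp add: q_def power3_eq_cube flip: power_mult_distrib)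
  define V where "V = (frob_fixed k \<times> frob_fixed k \<times> frob_fixed k ::
    (Enum.finite_3 alg_closure \<times> Enum.finite_3 alg_closure \<times> Enum.finite_3 alg_closure) set)"
  note cF = frob_fixed_card[OF three_eq_0 \<open>k \<ge> 1\<close>]
  have "finite V" "card V = q ^ 3" using cF by (auto simp: V_def card_cartesian_product q_def power3_eq_cube)
  then have "card V \<le> n" using k q3 by simp
  obtain g :: "Enum.finite_3 alg_closure" where g: "g \<in> frob_fixed k" "\<forall>s\<in>frob_fixed k. s\<^sup>2 \<noteq> g"
    using frob_fixed_nonsquare[OF three_eq_0 \<open>k \<ge> 1\<close>] by blast
  obtain G \<beta> where G: "G \<subseteq> {..<n} \<times> {..<n}" "card G = (\<Sum>v\<in>V. card {w\<in>V. quadric_rel g v w})"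
    and \<beta>: "\<And>i j. (i, j) \<in> G \<Longrightarrow> \<beta> i \<in> V \<and> \<beta> j \<in> V \<and> quadric_rel g (\<beta> i) (\<beta> j)"
    and inj: "\<And>i j i' j'. (i, j) \<in> G \<Longrightarrow> (i', j') \<in> G \<Longrightarrow> (\<beta> i = \<beta> i' \<longleftrightarrow> i = i') \<and> (\<beta> j = \<beta> j' \<longleftrightarrow> j = j')"
    by (rule relation_graph[OF \<open>finite V\<close> \<open>card V \<le> n\<close>, of "quadric_rel g"]) blast
  have cardG: "q ^ 4 * (q - 1) \<le> card G"
    unfolding G(2) V_def q_def by (rule quadric_rel_card[OF three_eq_0 \<open>k \<ge> 1\<close> g(1)])
  \<comment> \<open>Three sets with the common triple 0, 1, 2. Among four columns only two sets
    contain a given triple, so K_{3,3} needs five columns, that is d = 4.\<close>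
  define t1 t2 t3 :: "nat set" where t: "t1 = {0, 1, 2}" "t2 = {0, 1, 2, 3}" "t3 = {0, 1, 2, 4}"
  define T where "T = {t1, t2, t3}"
  have "\<not> has_pattern T 4 n G"
  proof
    assume "has_pattern T 4 n G"
    then obtain \<rho> c where \<rho>: "inj_on \<rho> T" and c: "inj_on c {..4}"
      and e: "\<And>t j. t \<in> T \<Longrightarrow> j \<in> t \<Longrightarrow> (\<rho> t, c j) \<in> G" unfolding has_pattern_def by blast
    have sub: "{0, 1, 2} \<subseteq> t" if "t \<in> T" for t using that by (auto simp: T_def t)
    have e': "(\<rho> s, c j) \<in> G" if "s \<in> T" "j \<in> {0, 1, 2}" for s j using e[OF that(1)] sub[OF that(1)] that(2) by blast
    have T3: "t1 \<in> T" "t2 \<in> T" "t3 \<in> T" by (auto simp: T_def)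
    have "3 \<in> t2" "3 \<notin> t1" "4 \<in> t3" "4 \<notin> t1" "4 \<notin> t2" by (auto simp: t)
    then have tne: "t1 \<noteq> t2" "t1 \<noteq> t3" "t2 \<noteq> t3" by auto
    have \<rho>ne: "\<beta> (\<rho> s) \<noteq> \<beta> (\<rho> s')" if "s \<in> T" "s' \<in> T" "s \<noteq> s'" for s s'
      using inj[OF e'[OF that(1), of 0] e'[OF that(2), of 0]] inj_onD[OF \<rho> _ that(1,2)] that(3) by auto
    have cne: "\<beta> (c j) \<noteq> \<beta> (c j')" if "j \<in> {0, 1, 2}" "j' \<in> {0, 1, 2}" "j \<noteq> j'" for j j'
      using inj[OF e'[OF T3(1) that(1)] e'[OF T3(1) that(2)]] inj_onD[OF c, of j j'] that by auto
    have rel: "\<beta> (\<rho> s) \<in> V \<and> \<beta> (c j) \<in> V \<and> quadric_rel g (\<beta> (\<rho> s)) (\<beta> (c j))"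
      if "s \<in> T" "j \<in> {0, 1, 2}" for s j
      using \<beta>[OF e'[OF that]] .
    show False
    proof (rule quadric_rel_K33_free[OF three_eq_0 g(2)])
      show "{\<beta> (\<rho> t1), \<beta> (\<rho> t2), \<beta> (\<rho> t3), \<beta> (c 0), \<beta> (c 1), \<beta> (c 2)}
          \<subseteq> frob_fixed k \<times> frob_fixed k \<times> frob_fixed k"
        using rel[OF T3(1), of 0] rel[OF T3(1), of 1] rel[OF T3(1), of 2] rel[OF T3(2), of 0] rel[OF T3(3), of 0]
        unfolding V_def by simp
      show "quadric_rel g v w"
        if "v \<in> {\<beta> (\<rho> t1), \<beta> (\<rho> t2), \<beta> (\<rho> t3)}" "w \<in> {\<beta> (c 0), \<beta> (c 1), \<beta> (c 2)}" for v w
        using that rel T3 by auto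
    qed (use \<rho>ne cne T3 tne in simp_all)
  qed
  moreover have "real n powr (2 - 1 / 3) / 486 \<le> card G"
  proof -
    \<comment> \<open>The constant is 486 = 2 * 3^5: the power comes from replacing n by (3 q)^3,
      the 2 from q - 1 >= q / 2.\<close>
    have "n \<le> (3 * q) ^ 3" using k q3 by (simp add: power_mult_distrib)
    then have "real n \<le> (3 * real q) ^ 3" by (metis of_nat_le_iff of_nat_mult of_nat_numeral of_nat_power)
    also have "\<dots> = (3 * real q) powr 3" by simp
    finally have "real n powr (5 / 3) \<le> ((3 * real q) powr 3) powr (5 / 3)" by (intro powr_mono2) auto
    also have "\<dots> = (3 * real q) powr 5" unfolding powr_powr by simp
    also have "\<dots> = (3 * real q) ^ 5" by simp
    also have "\<dots> = 243 * (real q ^ 4 * real q)" by (simp add: power_mult_distrib numeral_eq_Suc)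
    also have "\<dots> \<le> 243 * (2 * real (q ^ 4 * (q - 1)))"
    proof -
      have "q \<ge> 2" using \<open>k \<ge> 1\<close> self_le_power[of "3::nat" k] by (simp add: q_def)
      then have "real q \<le> 2 * real (q - 1)" by simp
      then have "real q ^ 4 * real q \<le> real q ^ 4 * (2 * real (q - 1))" by (intro mult_left_mono) auto
      then show ?thesis by (simp add: mult_ac)
    qed
    also have "\<dots> \<le> 243 * (2 * real (card G))" using cardG by (intro mult_left_mono) (auto simp only: of_nat_le_iff)
    finally show ?thesis by simp
  qed
  moreover have "T \<subseteq> Pow {..4}" "{} \<notin> T" by (auto simp: T_def t)
  ultimately show ?thesis using G(1)
    by (intro exI[of _ T] exI[of _ G] conjI)
qed

section \<open>The lower bounds\<close>

lemma max_sign_rank_bigomega: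
  fixes a C :: real
  assumes "C > 0" "a \<le> 2"
    and free: "\<And>n. n \<ge> n\<^sub>0 \<Longrightarrow> \<exists>T G. T \<subseteq> Pow {..d} \<and> {} \<notin> T \<and> G \<subseteq> {..<n} \<times> {..<n} \<and>
      \<not> has_pattern T d n G \<and> real n powr (2 - a) / C \<le> card G"
  shows "(\<lambda>N. real (max_sign_rank N d)) \<in> \<Omega>(\<lambda>N. real N powr (1 - a) / ln (real N))"
proof (rule landau_omega.bigI)
  \<comment> \<open>The 8 is 2 from the exponent \<open>2 * N * r\<close> times 4 from
    \<open>Suc (4 * N\<^sup>2) \<le> N ^ 4\<close>, valid as N >= 3; \<open>2 powr (2 - a)\<close>
    pays for n >= N / 2. The threshold on \<open>N\<close> below secures both.\<close>
  define c where "c = ln 2 / (8 * C * 2 powr (2 - a))"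
  show "c > 0" using \<open>C > 0\<close> by (simp add: c_def)
  show "\<forall>\<^sub>F N in at_top. c * norm (real N powr (1 - a) / ln (real N)) \<le> norm (real (max_sign_rank N d))"
    using eventually_ge_at_top[of "n\<^sub>0 + 2 * 2 ^ d + 3"]
  proof eventually_elim
    fix N :: nat assume N: "n\<^sub>0 + 2 * 2 ^ d + 3 \<le> N"
    define n where "n = N - 2 ^ d"
    define r where "r = max_sign_rank N d"
    have n: "n \<ge> n\<^sub>0" "N = n + 2 ^ d" "N \<le> 2 * n" "N \<ge> 3" using N by (auto simp: n_def)
    have half: "real N / 2 \<le> real n" using n(3) by simp
    obtain T G where TG: "T \<subseteq> Pow {..d}" "{} \<notin> T" "G \<subseteq> {..<n} \<times> {..<n}" "\<not> has_pattern T d n G"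
      "real n powr (2 - a) / C \<le> card G"
      using free[OF n(1)] by blast
    have lnN: "ln (real N) > 0" using n(4) by simp
    have "real (2 ^ card G) \<le> real (Suc (4 * N\<^sup>2) ^ (2 * N * r))"
      unfolding of_nat_le_iff r_def by (rule two_power_card_le[OF TG(3,4,1,2) n(2)])
    then have "2 ^ card G \<le> real (Suc (4 * N\<^sup>2)) ^ (2 * N * r)"
      by (simp only: of_nat_power of_nat_numeral)
    moreover have "0 < real (Suc (4 * N\<^sup>2)) ^ (2 * N * r)" 
      by (simp only: zero_less_power of_nat_0_less_iff zero_less_Suc)
    ultimately have "ln (2 ^ card G) \<le> ln (real (Suc (4 * N\<^sup>2)) ^ (2 * N * r))"
      by (subst ln_le_cancel_iff) (simp_all only: zero_less_power zero_less_numeral)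
    then have "card G * ln 2 \<le> (2 * N * r) * ln (real (Suc (4 * N\<^sup>2)))"
      by (simp only: ln_realpow)
    also have "\<dots> \<le> (2 * N * r) * (4 * ln (real N))"
    proof (rule mult_left_mono)
      have "9 * N\<^sup>2 \<le> N\<^sup>2 * N\<^sup>2" using power_mono[OF n(4), of 2] by (intro mult_right_mono) auto
      moreover have "1 \<le> N\<^sup>2" using n(4) by simp
      ultimately have "Suc (4 * N\<^sup>2) \<le> N\<^sup>2 * N\<^sup>2" by linarith
      also have "\<dots> = N ^ 4" by (simp flip: power_add)
      finally have "Suc (4 * N\<^sup>2) \<le> N ^ 4" .
      then have "real (Suc (4 * N\<^sup>2)) \<le> real N ^ 4" by (metis of_nat_le_iff of_nat_power)
      moreover have "0 < real (Suc (4 * N\<^sup>2))" by (simp only: of_nat_0_less_iff zero_less_Suc)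
      moreover have "0 < real N" using n(4) by simp
      ultimately have "ln (real (Suc (4 * N\<^sup>2))) \<le> ln (real N ^ 4)"
        using ln_le_cancel_iff zero_less_power by blast
      also have "\<dots> = 4 * ln (real N)" by (simp add: ln_realpow)
      finally show "ln (real (Suc (4 * N\<^sup>2))) \<le> 4 * ln (real N)" .
    qed simp
    finally have upper: "card G * ln 2 \<le> 8 * N * r * ln (real N)" by simp
    have "(real N / 2) powr (2 - a) \<le> real n powr (2 - a)"
      using half \<open>a \<le> 2\<close> by (intro powr_mono2) auto
    then have "(real N / 2) powr (2 - a) / C * ln 2 \<le> real n powr (2 - a) / C * ln 2"
      using \<open>C > 0\<close> by (intro mult_right_mono divide_right_mono) auto
    also have "\<dots> \<le> card G * ln 2" using TG(5) by (intro mult_right_mono) auto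
    also note upper
    finally have le: "(real N / 2) powr (2 - a) / C * ln 2 \<le> 8 * N * r * ln (real N)" .
    have "(real N / 2) powr (2 - a) / C * ln 2 = 8 * real N * (c * real N powr (1 - a))"
    proof -
      have "real N powr (2 - a) = real N powr (1 + (1 - a))" by simp
      also have "\<dots> = real N * real N powr (1 - a)" using n(4) by (subst powr_add) simp
      finally show ?thesis using \<open>C > 0\<close> by (simp add: c_def powr_divide mult_ac)
    qed
    with le have "8 * real N * (c * real N powr (1 - a)) \<le> 8 * real N * (r * ln (real N))" by simp
    then have "c * real N powr (1 - a) \<le> r * ln (real N)" using n(4) by simp
    then have "c * real N powr (1 - a) / ln (real N) \<le> r" using lnN by (simp add: divide_le_eq)
    then show "c * norm (real N powr (1 - a) / ln (real N)) \<le> norm (real (max_sign_rank N d))"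
      using lnN by (simp add: r_def)
  qed
qed

theorem theorem6:
  shows "(\<lambda>N. real (max_sign_rank N 2)) \<in> \<Omega>(\<lambda>N. real N powr (1 / 2) / ln (real N)) \<and>
    (\<lambda>N. real (max_sign_rank N 3)) \<in> \<Omega>(\<lambda>N. real N powr (8 / 15) / ln (real N)) \<and>
    (\<lambda>N. real (max_sign_rank N 4)) \<in> \<Omega>(\<lambda>N. real N powr (2 / 3) / ln (real N)) \<and>
    (\<forall>d::nat. d > 4 \<longrightarrow>
      (\<lambda>N. real (max_sign_rank N d)) \<in> \<Omega>(\<lambda>N.
        real N powr (1 - (real d ^ 2 + 5 * real d + 2) / (real d ^ 3 + 2 * real d ^ 2 + 3 * real d))
          / ln (real N)))"
proof (intro conjI allI impI)
  show "(\<lambda>N. real (max_sign_rank N 2)) \<in> \<Omega>(\<lambda>N. real N powr (1 / 2) / ln (real N))"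
    using max_sign_rank_bigomega[OF _ _ exists_large_pattern_free_2] by simp
  show "(\<lambda>N. real (max_sign_rank N 3)) \<in> \<Omega>(\<lambda>N. real N powr (8 / 15) / ln (real N))"
    using max_sign_rank_bigomega[OF _ _ exists_large_pattern_free_3] by simp
  show "(\<lambda>N. real (max_sign_rank N 4)) \<in> \<Omega>(\<lambda>N. real N powr (2 / 3) / ln (real N))"
    using max_sign_rank_bigomega[OF _ _ exists_large_pattern_free_4] by simp
  fix d :: nat assume d: "d > 4"
  define D where "D = real d ^ 3 + 2 * real d ^ 2 + 3 * real d"
  have "real d ^ 2 + 5 * real d + 2 \<le> 2 * D"
  proof -
    have ineq: "x + 5 * y + 2 \<le> 2 * (z + 2 * x + 3 * y)" if "1 \<le> z" "1 \<le> y" "0 \<le> x" for x y z :: real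
      using that by argo
    show ?thesis unfolding D_def by (rule ineq) (use d in simp_all)
  qed
  moreover have "D > 0" using d by (simp add: D_def add_pos_pos)
  ultimately have "(real d ^ 2 + 5 * real d + 2) / D \<le> 2" by (simp add: divide_le_eq)
  then show "(\<lambda>N. real (max_sign_rank N d)) \<in> \<Omega>(\<lambda>N.
        real N powr (1 - (real d ^ 2 + 5 * real d + 2) / (real d ^ 3 + 2 * real d ^ 2 + 3 * real d))
          / ln (real N))"
    unfolding D_def[symmetric]
    using exists_large_pattern_free_ge[of _ d, folded D_def] d
    by (intro max_sign_rank_bigomega[of 4 _ 1]) auto
qed

end
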